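(* There are operator spaces $X$ and $Y$ such that $X$ almost completely isometrically embeds into $Y$ but $X$ does not $\mathbb{R}$-isomorphically embed into $Y$. In particular: (1) Almost complete isometric embeddability is strictly weaker than almost complete $\mathbb{R}$-linear isometric embeddability (i.e. the latter implies the former, but there are operator spaces $X,Y$ for which the former holds and the latter fails). (2) Almost complete Lipschitz embeddability is strictly weaker than almost complete $\mathbb{R}$-isomorphic embeddability (i.e. the latter implies the former, but there are operator spaces $X,Y$ for which the former holds and the latter fails).
   Context: An operator space is a closed $\mathbb{C}$-linear subspace $X\subset \mathcal{B}(H)$ for a (complex) Hilbert space $H$; for $n\in\mathbb{N}$, $\mathrm{M}_n(X)$ carries the norm inherited from $\mathcal{B}(H^{\oplus n})$, where $H^{\oplus n}$ is the $\ell_2$-sum of $n$ copies of $H$. For a map $f:X\to Y$ (not necessarily linear), the $n$-th amplification is $f_n:\mathrm{M}_n(X)\to \mathrm{M}_n(Y)$, $f_n([x_{ij}])=[f(x_{ij})]$. The Lipschitz distortion of an injective map $g$ between metric spaces $(A,d)$ and $(B,\partial)$ is the infimum of all $D>0$ for which there is $r>0$ with $r\,d(x,y)\le \partial(g(x),g(y))\le Dr\,d(x,y)$ for all $x,y\in A$; $g$ is a Lipschitz embedding if it is injective, Lipschitz, and $g^{-1}:g(A)\to A$ is Lipschitz. A sequence of (arbitrary) maps $(f^n:X\to Y)_n$ is an almost complete isometric embedding if for each $n$ the $n$-th amplification $f^n_n:\mathrm{M}_n(X)\to\mathrm{M}_n(Y)$ of $f^n$ is an isometry (distance preserving, not assumed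 onto); it is an almost complete Lipschitz embedding if there is $D>0$ such that each $f^n_n$ is a Lipschitz embedding with distortion at most $D$. If such a sequence exists, $X$ is said to almost completely isometrically (resp. almost completely Lipschitzly) embed into $Y$. If moreover all the $f^n$ are $\mathbb{R}$-linear, one speaks of an almost complete $\mathbb{R}$-linear isometric embedding (each $f^n_n$ an isometry), respectively an almost complete $\mathbb{R}$-isomorphic embedding (each $f^n_n$ an isomorphism onto its image with distortion at most a common constant $D$). $X$ $\mathbb{R}$-isomorphically embeds into $Y$ if there is a bounded $\mathbb{R}$-linear map $X\to Y$ which is an isomorphism onto its image (bounded below) in the Banach space sense. *)

theory Defs
  imports "HOL-Analysis.Analysis"
begin

section \<open>Complex Hilbert spaces\<close>

class complex_vector = real_vector +
  fixes scaleC :: "complex \<Rightarrow> 'a \<Rightarrow> 'a" (infixr "*\<^sub>C" 75)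
  assumes scaleC_add_right: "c *\<^sub>C (x + y) = c *\<^sub>C x + c *\<^sub>C y"
    and scaleC_add_left: "(b + c) *\<^sub>C x = b *\<^sub>C x + c *\<^sub>C x"
    and scaleC_scaleC: "b *\<^sub>C c *\<^sub>C x = (b * c) *\<^sub>C x"
    and scaleC_of_real: "complex_of_real r *\<^sub>C x = r *\<^sub>R x"

text \<open>The complex inner product is antilinear in the first argument. Positive definiteness and
  the formula for the norm are inherited from \<^class>\<open>real_inner\<close>, since
  \<open>cinner x x\<close> is real by hermitian symmetry.\<close>

class complex_hilbert_space = complex_vector + real_inner + complete_space +
  fixes cinner :: "'a \<Rightarrow> 'a \<Rightarrow> complex"
  assumes cinner_commute: "cinner x y = cnj (cinner y x)"
    and cinner_add_left: "cinner (x + y) z = cinner x z + cinner y z"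
    and cinner_scaleC_left: "cinner (c *\<^sub>C x) y = cnj c * cinner x y"
    and inner_eq_Re_cinner: "inner x y = Re (cinner x y)"

lemma norm_scaleC:
  fixes x :: "'a::complex_hilbert_space"
  shows "norm (c *\<^sub>C x) = cmod c * norm x"
proof -
  have "cinner (c *\<^sub>C x) (c *\<^sub>C x) = cnj c * c * cinner x x"
    by (subst cinner_scaleC_left, subst cinner_commute, subst cinner_scaleC_left)
       (simp add: cinner_commute[of x x, symmetric])
  also have "cnj c * c = complex_of_real ((cmod c)\<^sup>2)"
    by (simp only: complex_norm_square mult.commute)
  finally have "inner (c *\<^sub>C x) (c *\<^sub>C x) = (cmod c)\<^sup>2 * inner x x"
    by (simp add: inner_eq_Re_cinner)
  then show ?thesis
    by (simp add: norm_eq_sqrt_inner real_sqrt_mult)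
qed

subsection \<open>The Hilbert space of square-summable families\<close>

typedef 'i ell2 = "{f :: 'i \<Rightarrow> complex. (\<lambda>i. (cmod (f i))\<^sup>2) summable_on UNIV}"
  by (rule exI[of _ "\<lambda>_. 0"]) simp

setup_lifting type_definition_ell2

lemma ell2_add:
  assumes "(\<lambda>i. (cmod (f i))\<^sup>2) summable_on UNIV" "(\<lambda>i. (cmod (g i))\<^sup>2) summable_on UNIV"
  shows "(\<lambda>i. (cmod (f i + g i))\<^sup>2) summable_on UNIV"
proof (rule summable_on_comparison_test)
  show "(\<lambda>i. 2 * (cmod (f i))\<^sup>2 + 2 * (cmod (g i))\<^sup>2) summable_on UNIV"
    by (intro summable_on_add summable_on_cmult_right assms)
  fix i
  have "(cmod (f i + g i))\<^sup>2 \<le> (cmod (f i) + cmod (g i))\<^sup>2"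
    by (intro power_mono norm_triangle_ineq) auto
  also have "\<dots> \<le> 2 * (cmod (f i))\<^sup>2 + 2 * (cmod (g i))\<^sup>2"
    using sum_squares_ge_zero[of "cmod (f i) - cmod (g i)" 0]
    by (simp add: power2_eq_square algebra_simps)
  finally show "(cmod (f i + g i))\<^sup>2 \<le> 2 * (cmod (f i))\<^sup>2 + 2 * (cmod (g i))\<^sup>2" .
qed auto

lemma ell2_scale:
  assumes "(\<lambda>i. (cmod (f i))\<^sup>2) summable_on UNIV"
  shows "(\<lambda>i. (cmod (c * f i))\<^sup>2) summable_on UNIV"
  by (simp add: norm_mult power_mult_distrib summable_on_cmult_right assms)

lemma ell2_mult:
  assumes "(\<lambda>i. (cmod (f i))\<^sup>2) summable_on UNIV" "(\<lambda>i. (cmod (g i))\<^sup>2) summable_on UNIV"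
  shows "(\<lambda>i. cnj (f i) * g i) summable_on UNIV"
proof (rule abs_summable_summable, rule summable_on_comparison_test)
  show "(\<lambda>i. (cmod (f i))\<^sup>2 + (cmod (g i))\<^sup>2) summable_on UNIV"
    by (intro summable_on_add assms)
  fix i
  have "2 * (cmod (f i) * cmod (g i)) \<le> (cmod (f i))\<^sup>2 + (cmod (g i))\<^sup>2"
    using sum_squares_ge_zero[of "cmod (f i) - cmod (g i)" 0]
    by (simp add: power2_eq_square algebra_simps)
  moreover have "0 \<le> cmod (f i) * cmod (g i)" by simp
  ultimately have "cmod (f i) * cmod (g i) \<le> (cmod (f i))\<^sup>2 + (cmod (g i))\<^sup>2"
    by linarith
  then show "norm (cnj (f i) * g i) \<le> (cmod (f i))\<^sup>2 + (cmod (g i))\<^sup>2"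
    by (simp add: norm_mult)
qed auto

instantiation ell2 :: (type) complex_vector
begin
lift_definition zero_ell2 :: "'a ell2" is "\<lambda>_. 0" by simp
lift_definition uminus_ell2 :: "'a ell2 \<Rightarrow> 'a ell2" is "\<lambda>f i. - f i" by simp
lift_definition plus_ell2 :: "'a ell2 \<Rightarrow> 'a ell2 \<Rightarrow> 'a ell2" is "\<lambda>f g i. f i + g i"
  by (rule ell2_add)
lift_definition minus_ell2 :: "'a ell2 \<Rightarrow> 'a ell2 \<Rightarrow> 'a ell2" is "\<lambda>f g i. f i - g i"
  using ell2_add[of _ "\<lambda>i. - _ i"] by simp
lift_definition scaleR_ell2 :: "real \<Rightarrow> 'a ell2 \<Rightarrow> 'a ell2" is "\<lambda>r f i. complex_of_real r * f i"
  by (rule ell2_scale)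
lift_definition scaleC_ell2 :: "complex \<Rightarrow> 'a ell2 \<Rightarrow> 'a ell2" is "\<lambda>c f i. c * f i"
  by (rule ell2_scale)
instance
  by standard (transfer; simp add: fun_eq_iff algebra_simps)+
end

instantiation ell2 :: (type) real_inner
begin
lift_definition inner_ell2 :: "'a ell2 \<Rightarrow> 'a ell2 \<Rightarrow> real"
  is "\<lambda>f g. Re (\<Sum>\<^sub>\<infinity>i. cnj (f i) * g i)" .
definition norm_ell2 :: "'a ell2 \<Rightarrow> real" where "norm_ell2 x = sqrt (inner x x)"
definition sgn_ell2 :: "'a ell2 \<Rightarrow> 'a ell2" where "sgn_ell2 x = x /\<^sub>R norm x"
definition dist_ell2 :: "'a ell2 \<Rightarrow> 'a ell2 \<Rightarrow> real" where "dist_ell2 x y = norm (x - y)"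
definition uniformity_ell2 :: "('a ell2 \<times> 'a ell2) filter"
  where "uniformity_ell2 = (INF e\<in>{0 <..}. principal {(x, y). dist x y < e})"
definition open_ell2 :: "'a ell2 set \<Rightarrow> bool"
  where "open_ell2 U = (\<forall>x\<in>U. \<forall>\<^sub>F (x', y) in uniformity. x' = x \<longrightarrow> y \<in> U)"

lemma inner_ell2_self: "inner (x::'a ell2) x = (\<Sum>\<^sub>\<infinity>i. (cmod (Rep_ell2 x i))\<^sup>2)"
proof -
  have "Re (\<Sum>\<^sub>\<infinity>i. cnj (Rep_ell2 x i) * Rep_ell2 x i)
      = (\<Sum>\<^sub>\<infinity>i. Re (cnj (Rep_ell2 x i) * Rep_ell2 x i))"
    by (rule infsum_Re[symmetric]) (use ell2_mult Rep_ell2 in blast)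
  also have "\<dots> = (\<Sum>\<^sub>\<infinity>i. (cmod (Rep_ell2 x i))\<^sup>2)"
    by (intro infsum_cong) (simp add: cmod_power2, simp add: power2_eq_square)
  finally show ?thesis by (simp add: inner_ell2.rep_eq)
qed

instance
proof
  fix x y z :: "'a ell2" and r :: real
  have summ: "(\<lambda>i. cnj (Rep_ell2 u i) * Rep_ell2 v i) summable_on UNIV" for u v :: "'a ell2"
    using ell2_mult Rep_ell2 by blast
  show "inner x y = inner y x"
  proof -
    have "(\<Sum>\<^sub>\<infinity>i. cnj (Rep_ell2 x i) * Rep_ell2 y i) = cnj (\<Sum>\<^sub>\<infinity>i. cnj (Rep_ell2 y i) * Rep_ell2 x i)"
      by (subst infsum_cnj[symmetric]) (simp add: mult.commute)
    then show ?thesis by (simp add: inner_ell2.rep_eq)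
  qed
  show "inner (x + y) z = inner x z + inner y z"
    by (simp add: inner_ell2.rep_eq plus_ell2.rep_eq distrib_right infsum_add summ)
  show "inner (r *\<^sub>R x) y = r * inner x y"
    by (simp add: inner_ell2.rep_eq scaleR_ell2.rep_eq mult.assoc infsum_cmult_right')
  show "0 \<le> inner x x"
    by (simp add: inner_ell2_self infsum_nonneg)
  show "inner x x = 0 \<longleftrightarrow> x = 0"
  proof
    assume *: "inner x x = 0"
    have "(cmod (Rep_ell2 x i))\<^sup>2 = 0" for i
      by (rule nonneg_infsum_le_0D[of "\<lambda>i. (cmod (Rep_ell2 x i))\<^sup>2" UNIV])
         (use * Rep_ell2[of x] in \<open>auto simp: inner_ell2_self\<close>)
    then show "x = 0"
      by (intro Rep_ell2_inject[THEN iffD1]) (auto simp: zero_ell2.rep_eq)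
  qed (simp add: inner_ell2.rep_eq zero_ell2.rep_eq)
qed (simp_all add: norm_ell2_def sgn_ell2_def dist_ell2_def uniformity_ell2_def open_ell2_def)
end

instance ell2 :: (type) complete_space
proof
  fix X :: "nat \<Rightarrow> 'a ell2"
  assume X: "Cauchy X"
  have norm2: "(norm x)\<^sup>2 = (\<Sum>\<^sub>\<infinity>i. (cmod (Rep_ell2 x i))\<^sup>2)" for x :: "'a ell2"
    by (simp add: power2_norm_eq_inner inner_ell2_self)
  have summ: "(\<lambda>i. (cmod (Rep_ell2 x i))\<^sup>2) summable_on UNIV" for x :: "'a ell2"
    using Rep_ell2 by auto
  have part: "(\<Sum>i\<in>F. (cmod (Rep_ell2 x i))\<^sup>2) \<le> (norm x)\<^sup>2" if "finite F" for F and x :: "'a ell2"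
    unfolding norm2 by (rule finite_sum_le_infsum[OF summ that]) auto
  have coord: "cmod (Rep_ell2 x i) \<le> norm x" for i and x :: "'a ell2"
    using part[of "{i}" x] by (simp add: power2_le_iff_abs_le)
  have rd: "Rep_ell2 (x - y) i = Rep_ell2 x i - Rep_ell2 y i" for i and x y :: "'a ell2"
    by (simp add: minus_ell2.rep_eq)
  have "Cauchy (\<lambda>n. Rep_ell2 (X n) i)" for i
  proof (rule CauchyI)
    fix e :: real assume "0 < e"
    then obtain M where "\<forall>m\<ge>M. \<forall>n\<ge>M. norm (X m - X n) < e"
      using CauchyD[OF X] by blast
    then show "\<exists>M. \<forall>m\<ge>M. \<forall>n\<ge>M. norm (Rep_ell2 (X m) i - Rep_ell2 (X n) i) < e"
      using coord le_less_trans unfolding rd[symmetric] by blast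
  qed
  then obtain g where g: "(\<lambda>n. Rep_ell2 (X n) i) \<longlonglongrightarrow> g i" for i
    unfolding Cauchy_convergent_iff convergent_def by metis
  have tail: "\<exists>M. \<forall>n\<ge>M. \<forall>F. finite F \<longrightarrow> (\<Sum>i\<in>F. (cmod (Rep_ell2 (X n) i - g i))\<^sup>2) \<le> e\<^sup>2"
    if "0 < e" for e
  proof -
    obtain M where M: "\<forall>m\<ge>M. \<forall>n\<ge>M. norm (X m - X n) < e"
      using CauchyD[OF X \<open>0 < e\<close>] by blast
    have "(\<Sum>i\<in>F. (cmod (Rep_ell2 (X n) i - g i))\<^sup>2) \<le> e\<^sup>2" if "n \<ge> M" "finite F" for n F
    proof (rule LIMSEQ_le_const2)
      show "(\<lambda>m. \<Sum>i\<in>F. (cmod (Rep_ell2 (X n) i - Rep_ell2 (X m) i))\<^sup>2)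
              \<longlonglongrightarrow> (\<Sum>i\<in>F. (cmod (Rep_ell2 (X n) i - g i))\<^sup>2)"
        by (intro tendsto_intros g)
      have "(\<Sum>i\<in>F. (cmod (Rep_ell2 (X n) i - Rep_ell2 (X m) i))\<^sup>2) \<le> e\<^sup>2" if "m \<ge> M" for m
      proof -
        have "(\<Sum>i\<in>F. (cmod (Rep_ell2 (X n) i - Rep_ell2 (X m) i))\<^sup>2) \<le> (norm (X n - X m))\<^sup>2"
          using part[OF \<open>finite F\<close>, of "X n - X m"] by (simp add: rd)
        also have "\<dots> \<le> e\<^sup>2"
          using M that \<open>n \<ge> M\<close> by (intro power_mono) (auto intro: less_imp_le)
        finally show ?thesis .
      qed
      then show "\<exists>N. \<forall>m\<ge>N. (\<Sum>i\<in>F. (cmod (Rep_ell2 (X n) i - Rep_ell2 (X m) i))\<^sup>2) \<le> e\<^sup>2"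
        by blast
    qed
    then show ?thesis by blast
  qed
  have diff: "(\<lambda>i. (cmod (Rep_ell2 (X n) i - g i))\<^sup>2) summable_on UNIV"
    if "\<forall>F. finite F \<longrightarrow> (\<Sum>i\<in>F. (cmod (Rep_ell2 (X n) i - g i))\<^sup>2) \<le> e\<^sup>2" for n e
    by (rule nonneg_bdd_above_summable_on) (use that in \<open>auto intro!: bdd_aboveI2\<close>)
  obtain M where M: "\<forall>n\<ge>M. \<forall>F. finite F \<longrightarrow> (\<Sum>i\<in>F. (cmod (Rep_ell2 (X n) i - g i))\<^sup>2) \<le> 1\<^sup>2"
    using tail[of 1] by auto
  have "(\<lambda>i. (cmod (Rep_ell2 (X M) i + (- 1) * (Rep_ell2 (X M) i - g i)))\<^sup>2) summable_on UNIV"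
    by (intro ell2_add ell2_scale summ diff) (use M in blast)
  then have gs: "(\<lambda>i. (cmod (g i))\<^sup>2) summable_on UNIV"
    by simp
  define G where "G = Abs_ell2 g"
  have RG: "Rep_ell2 G = g"
    unfolding G_def by (rule Abs_ell2_inverse) (use gs in simp)
  have "X \<longlonglongrightarrow> G"
  proof (rule LIMSEQ_I)
    fix r :: real assume "0 < r"
    then obtain M where M: "\<forall>n\<ge>M. \<forall>F. finite F \<longrightarrow>
        (\<Sum>i\<in>F. (cmod (Rep_ell2 (X n) i - g i))\<^sup>2) \<le> (r / 2)\<^sup>2"
      using tail[of "r / 2"] by auto
    have "norm (X n - G) < r" if "n \<ge> M" for n
    proof -
      have "(norm (X n - G))\<^sup>2 \<le> (r / 2)\<^sup>2"
        unfolding norm2 rd RG using M that by (intro infsum_le_finite_sums diff) auto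
      then have "norm (X n - G) \<le> r / 2"
        using \<open>0 < r\<close> by (intro power2_le_imp_le[of "norm (X n - G)"]) auto
      with \<open>0 < r\<close> show ?thesis by simp
    qed
    then show "\<exists>M. \<forall>n\<ge>M. norm (X n - G) < r" by blast
  qed
  then show "convergent X" by (auto simp: convergent_def)
qed

instantiation ell2 :: (type) complex_hilbert_space
begin
lift_definition cinner_ell2 :: "'a ell2 \<Rightarrow> 'a ell2 \<Rightarrow> complex"
  is "\<lambda>f g. \<Sum>\<^sub>\<infinity>i. cnj (f i) * g i" .
instance
proof
  fix x y z :: "'a ell2" and c :: complex
  have summ: "(\<lambda>i. cnj (Rep_ell2 u i) * Rep_ell2 v i) summable_on UNIV" for u v :: "'a ell2"
    using ell2_mult Rep_ell2 by blast
  show "cinner x y = cnj (cinner y x)"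
    unfolding cinner_ell2.rep_eq by (subst infsum_cnj[symmetric]) (simp add: mult.commute)
  show "cinner (x + y) z = cinner x z + cinner y z"
    by (simp add: cinner_ell2.rep_eq plus_ell2.rep_eq distrib_right infsum_add summ)
  show "cinner (c *\<^sub>C x) y = cnj c * cinner x y"
    by (simp add: cinner_ell2.rep_eq scaleC_ell2.rep_eq mult.assoc infsum_cmult_right')
  show "inner x y = Re (cinner x y)"
    by (simp add: cinner_ell2.rep_eq inner_ell2.rep_eq)
qed
end

section \<open>Operator spaces\<close>

instantiation blinfun :: (real_normed_vector, complex_hilbert_space) complex_vector
begin
lift_definition scaleC_blinfun :: "complex \<Rightarrow> 'a \<Rightarrow>\<^sub>L 'b \<Rightarrow> 'a \<Rightarrow>\<^sub>L 'b" is "\<lambda>c T \<xi>. c *\<^sub>C T \<xi>"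
proof -
  fix c :: complex and T :: "'a \<Rightarrow> 'b"
  assume "bounded_linear T"
  then interpret T: bounded_linear T .
  obtain K where K: "\<And>\<xi>. norm (T \<xi>) \<le> norm \<xi> * K"
    using T.bounded by blast
  have RC: "c *\<^sub>C r *\<^sub>R x = r *\<^sub>R c *\<^sub>C x" for r and x :: 'b
    by (simp flip: scaleC_of_real add: scaleC_scaleC mult.commute)
  show "bounded_linear (\<lambda>\<xi>. c *\<^sub>C T \<xi>)"
  proof (rule bounded_linear_intro[where K = "cmod c * K"])
    fix \<xi> show "norm (c *\<^sub>C T \<xi>) \<le> norm \<xi> * (cmod c * K)"
      using mult_left_mono[OF K, of "cmod c" \<xi>] by (simp add: norm_scaleC algebra_simps)
  qed (simp_all add: T.add T.scaleR scaleC_add_right RC)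
qed
instance
  by standard (transfer; simp add: fun_eq_iff scaleC_add_right scaleC_add_left scaleC_scaleC
      scaleC_of_real)+
end

text \<open>\<open>'h \<Rightarrow>\<^sub>L 'h\<close> consists of all bounded \<^emph>\<open>real\<close>-linear maps; the algebra
  of bounded operators of the complex Hilbert space is the following subset of it.\<close>

definition bounded_operators :: "('h::complex_hilbert_space \<Rightarrow>\<^sub>L 'h) set"
  where "bounded_operators = {T. \<forall>c \<xi>. blinfun_apply T (c *\<^sub>C \<xi>) = c *\<^sub>C blinfun_apply T \<xi>}"

definition operator_space :: "('h::complex_hilbert_space \<Rightarrow>\<^sub>L 'h) set \<Rightarrow> bool"
  where "operator_space X \<longleftrightarrow>
    X \<subseteq> bounded_operators \<and> closed X \<and> 0 \<in> X \<and>
    (\<forall>S\<in>X. \<forall>T\<in>X. S + T \<in> X) \<and> (\<forall>c. \<forall>T\<in>X. c *\<^sub>C T \<in> X)"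

text \<open>An \<open>n \<times> n\<close> matrix is a function on pairs of naturals that vanishes unless both indices
  are below \<open>n\<close>; this makes the representation unique.\<close>

definition matrices :: "nat \<Rightarrow> 'a::zero set \<Rightarrow> (nat \<Rightarrow> nat \<Rightarrow> 'a) set"
  where "matrices n X = {A. \<forall>i j. if i < n \<and> j < n then A i j \<in> X else A i j = 0}"

definition amplification ::
    "nat \<Rightarrow> ('a \<Rightarrow> 'b::zero) \<Rightarrow> (nat \<Rightarrow> nat \<Rightarrow> 'a) \<Rightarrow> nat \<Rightarrow> nat \<Rightarrow> 'b"
  where "amplification n f A = (\<lambda>i j. if i < n \<and> j < n then f (A i j) else 0)"

text \<open>The \<open>\<ell>\<^sub>2\<close>-sum of \<open>n\<close> copies of the Hilbert space consists of the tuples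
  \<open>\<xi> 0, \<dots>, \<xi> (n - 1)\<close>; \<open>matrix_norm\<close> is the operator norm with respect to it.\<close>

definition tuple_norm :: "nat \<Rightarrow> (nat \<Rightarrow> 'h::real_normed_vector) \<Rightarrow> real"
  where "tuple_norm n \<xi> = L2_set (\<lambda>i. norm (\<xi> i)) {..<n}"

definition matrix_norm :: "nat \<Rightarrow> (nat \<Rightarrow> nat \<Rightarrow> 'h::complex_hilbert_space \<Rightarrow>\<^sub>L 'h) \<Rightarrow> real"
  where "matrix_norm n A =
    (SUP \<xi>\<in>{\<xi>. tuple_norm n \<xi> \<le> 1}. tuple_norm n (\<lambda>i. \<Sum>j<n. blinfun_apply (A i j) (\<xi> j)))"

definition matrix_dist ::
    "nat \<Rightarrow> (nat \<Rightarrow> nat \<Rightarrow> 'h::complex_hilbert_space \<Rightarrow>\<^sub>L 'h) \<Rightarrow> (nat \<Rightarrow> nat \<Rightarrow> 'h \<Rightarrow>\<^sub>L 'h) \<Rightarrow> real"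
  where "matrix_dist n A B = matrix_norm n (\<lambda>i j. A i j - B i j)"

lemma bdd_above_matrix_norm:
  fixes A :: "nat \<Rightarrow> nat \<Rightarrow> 'h::complex_hilbert_space \<Rightarrow>\<^sub>L 'h"
  shows "bdd_above ((\<lambda>\<xi>. tuple_norm n (\<lambda>i. \<Sum>j<n. blinfun_apply (A i j) (\<xi> j)))
           ` {\<xi>. tuple_norm n \<xi> \<le> 1})"
proof (rule bdd_aboveI2)
  fix \<xi> :: "nat \<Rightarrow> 'h" assume "\<xi> \<in> {\<xi>. tuple_norm n \<xi> \<le> 1}"
  then have 1: "norm (\<xi> j) \<le> 1" if "j < n" for j
    using member_le_L2_set[of "{..<n}" j "\<lambda>i. norm (\<xi> i)"] that by (simp add: tuple_norm_def)
  have "norm (\<Sum>j<n. blinfun_apply (A i j) (\<xi> j)) \<le> (\<Sum>j<n. norm (A i j))" for i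
  proof (rule sum_norm_le)
    fix j assume "j \<in> {..<n}"
    then have "norm (A i j) * norm (\<xi> j) \<le> norm (A i j)"
      using 1 by (simp add: mult_left_le)
    then show "norm (blinfun_apply (A i j) (\<xi> j)) \<le> norm (A i j)"
      using norm_blinfun[of "A i j" "\<xi> j"] by linarith
  qed
  then show "tuple_norm n (\<lambda>i. \<Sum>j<n. blinfun_apply (A i j) (\<xi> j))
      \<le> L2_set (\<lambda>i. \<Sum>j<n. norm (A i j)) {..<n}"
    unfolding tuple_norm_def by (intro L2_set_mono) auto
qed

section \<open>Embeddings\<close>

text \<open>Metric spaces are given by a carrier set and a distance function.\<close>

definition isometry_on :: "'p set \<Rightarrow> ('p \<Rightarrow> 'p \<Rightarrow> real) \<Rightarrow> ('q \<Rightarrow> 'q \<Rightarrow> real) \<Rightarrow> ('p \<Rightarrow> 'q) \<Rightarrow> bool"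
  where "isometry_on A d d' g \<longleftrightarrow> (\<forall>x\<in>A. \<forall>y\<in>A. d' (g x) (g y) = d x y)"

definition lipschitz_embedding ::
    "'p set \<Rightarrow> ('p \<Rightarrow> 'p \<Rightarrow> real) \<Rightarrow> ('q \<Rightarrow> 'q \<Rightarrow> real) \<Rightarrow> ('p \<Rightarrow> 'q) \<Rightarrow> bool"
  where "lipschitz_embedding A d d' g \<longleftrightarrow>
    inj_on g A \<and>
    (\<exists>L. \<forall>x\<in>A. \<forall>y\<in>A. d' (g x) (g y) \<le> L * d x y) \<and>
    (\<exists>L. \<forall>x\<in>A. \<forall>y\<in>A. d x y \<le> L * d' (g x) (g y))"

text \<open>For a map that is not a Lipschitz embedding the infimum may range over the empty set and
  is then meaningless; bounds on the distortion are always paired with an embedding condition.\<close>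

definition distortion ::
    "'p set \<Rightarrow> ('p \<Rightarrow> 'p \<Rightarrow> real) \<Rightarrow> ('q \<Rightarrow> 'q \<Rightarrow> real) \<Rightarrow> ('p \<Rightarrow> 'q) \<Rightarrow> real"
  where "distortion A d d' g =
    Inf {D. D > 0 \<and> (\<exists>r>0. \<forall>x\<in>A. \<forall>y\<in>A.
      r * d x y \<le> d' (g x) (g y) \<and> d' (g x) (g y) \<le> D * r * d x y)}"

definition real_linear_on :: "'a::real_vector set \<Rightarrow> ('a \<Rightarrow> 'b::real_vector) \<Rightarrow> bool"
  where "real_linear_on X f \<longleftrightarrow>
    (\<forall>x\<in>X. \<forall>y\<in>X. f (x + y) = f x + f y) \<and> (\<forall>r. \<forall>x\<in>X. f (r *\<^sub>R x) = r *\<^sub>R f x)"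

text \<open>The isomorphism condition of a linear map (bounded and bounded below), for given norms.\<close>

definition isomorphic_embedding ::
    "'p set \<Rightarrow> ('p \<Rightarrow> real) \<Rightarrow> ('q \<Rightarrow> real) \<Rightarrow> ('p \<Rightarrow> 'q) \<Rightarrow> bool"
  where "isomorphic_embedding A N N' g \<longleftrightarrow>
    (\<exists>C. \<forall>x\<in>A. N' (g x) \<le> C * N x) \<and> (\<exists>c>0. \<forall>x\<in>A. c * N x \<le> N' (g x))"

definition real_isomorphically_embeds ::
    "('h::complex_hilbert_space \<Rightarrow>\<^sub>L 'h) set \<Rightarrow> ('k::complex_hilbert_space \<Rightarrow>\<^sub>L 'k) set \<Rightarrow> bool"
  where "real_isomorphically_embeds X Y \<longleftrightarrow>
    (\<exists>f. f \<in> X \<rightarrow> Y \<and> real_linear_on X f \<and> isomorphic_embedding X norm norm f)"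

text \<open>In the following definitions the \<open>n\<close>-th map is \<open>f n\<close>, for \<open>n \<ge> 1\<close>; the value
  \<open>f 0\<close> is irrelevant.\<close>

definition almost_complete_isometric_embedding ::
    "('h::complex_hilbert_space \<Rightarrow>\<^sub>L 'h) set \<Rightarrow> ('k::complex_hilbert_space \<Rightarrow>\<^sub>L 'k) set \<Rightarrow>
     (nat \<Rightarrow> ('h \<Rightarrow>\<^sub>L 'h) \<Rightarrow> ('k \<Rightarrow>\<^sub>L 'k)) \<Rightarrow> bool"
  where "almost_complete_isometric_embedding X Y f \<longleftrightarrow>
    (\<forall>n\<ge>1. f n \<in> X \<rightarrow> Y \<and>
      isometry_on (matrices n X) (matrix_dist n) (matrix_dist n) (amplification n (f n)))"

definition almost_complete_lipschitz_embedding ::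
    "('h::complex_hilbert_space \<Rightarrow>\<^sub>L 'h) set \<Rightarrow> ('k::complex_hilbert_space \<Rightarrow>\<^sub>L 'k) set \<Rightarrow>
     (nat \<Rightarrow> ('h \<Rightarrow>\<^sub>L 'h) \<Rightarrow> ('k \<Rightarrow>\<^sub>L 'k)) \<Rightarrow> bool"
  where "almost_complete_lipschitz_embedding X Y f \<longleftrightarrow>
    (\<exists>D>0. \<forall>n\<ge>1. f n \<in> X \<rightarrow> Y \<and>
      lipschitz_embedding (matrices n X) (matrix_dist n) (matrix_dist n) (amplification n (f n)) \<and>
      distortion (matrices n X) (matrix_dist n) (matrix_dist n) (amplification n (f n)) \<le> D)"

definition almost_complete_real_isomorphic_embedding ::
    "('h::complex_hilbert_space \<Rightarrow>\<^sub>L 'h) set \<Rightarrow> ('k::complex_hilbert_space \<Rightarrow>\<^sub>L 'k) set \<Rightarrow>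
     (nat \<Rightarrow> ('h \<Rightarrow>\<^sub>L 'h) \<Rightarrow> ('k \<Rightarrow>\<^sub>L 'k)) \<Rightarrow> bool"
  where "almost_complete_real_isomorphic_embedding X Y f \<longleftrightarrow>
    (\<exists>D>0. \<forall>n\<ge>1. f n \<in> X \<rightarrow> Y \<and> real_linear_on X (f n) \<and>
      isomorphic_embedding (matrices n X) (matrix_norm n) (matrix_norm n) (amplification n (f n)) \<and>
      distortion (matrices n X) (matrix_dist n) (matrix_dist n) (amplification n (f n)) \<le> D)"

definition almost_completely_isometrically_embeds ::
    "('h::complex_hilbert_space \<Rightarrow>\<^sub>L 'h) set \<Rightarrow> ('k::complex_hilbert_space \<Rightarrow>\<^sub>L 'k) set \<Rightarrow> bool"
  where "almost_completely_isometrically_embeds X Y \<longleftrightarrow>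
    (\<exists>f. almost_complete_isometric_embedding X Y f)"

definition almost_completely_real_linearly_isometrically_embeds ::
    "('h::complex_hilbert_space \<Rightarrow>\<^sub>L 'h) set \<Rightarrow> ('k::complex_hilbert_space \<Rightarrow>\<^sub>L 'k) set \<Rightarrow> bool"
  where "almost_completely_real_linearly_isometrically_embeds X Y \<longleftrightarrow>
    (\<exists>f. almost_complete_isometric_embedding X Y f \<and> (\<forall>n\<ge>1. real_linear_on X (f n)))"

definition almost_completely_lipschitzly_embeds ::
    "('h::complex_hilbert_space \<Rightarrow>\<^sub>L 'h) set \<Rightarrow> ('k::complex_hilbert_space \<Rightarrow>\<^sub>L 'k) set \<Rightarrow> bool"
  where "almost_completely_lipschitzly_embeds X Y \<longleftrightarrow>
    (\<exists>f. almost_complete_lipschitz_embedding X Y f)"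

definition almost_completely_real_isomorphically_embeds ::
    "('h::complex_hilbert_space \<Rightarrow>\<^sub>L 'h) set \<Rightarrow> ('k::complex_hilbert_space \<Rightarrow>\<^sub>L 'k) set \<Rightarrow> bool"
  where "almost_completely_real_isomorphically_embeds X Y \<longleftrightarrow>
    (\<exists>f. almost_complete_real_isomorphic_embedding X Y f)"

text \<open>Existential statements about operator spaces need a fixed ambient type, since types cannot be
  quantified. We take a Hilbert space whose Hilbert dimension is the cardinality of the power set
  of the reals; every Hilbert space of at most that dimension is a closed subspace of it.\<close>

type_synonym big_hilbert = "real set ell2"

end

theory Submission
  imports Defs
begin

text \<open>
  All operators below are diagonal, so the two operator spaces consist of bounded functions on an
  index set, and the norm of a matrix over them is the supremum over the indices of the norms of
  scalar matrices (\<open>matrix_norm_diagonal_le_iff\<close>). The domain is \<open>c\<^sub>0\<close> of the real line.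

  The nonlinear ingredient is the lifting of Aharoni and Lindenstrauss. Intervals of the form
  \<open>cell k j\<close> are countable in number, and a function \<open>a\<close> in \<open>c\<^sub>0\<close> gives a bounded function on
  them by taking the supremum of the positive part minus the supremum of the negative part, for the
  real and the imaginary part of \<open>a\<close>. This is \<open>4\<close>-Lipschitz (\<open>lift_on_lipschitz\<close>), and since \<open>a\<close>
  vanishes at infinity, \<open>a t\<close> is the limit of the values at the intervals that shrink to \<open>t\<close>
  (\<open>lift_on_tendsto\<close>).

  At level \<open>n\<close> the target contains the pairs of a function on the reals and a function on the cells
  such that the first is \<open>4 n\<^sup>2\<close> times the limit of the second. Send \<open>a\<close> to the pair of \<open>a\<close> and its
  lifting divided by \<open>4 n\<^sup>2\<close>. The first component alone preserves the norms of matrices, and the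
  second one is so small that, although the operator norm of an \<open>n \<times> n\<close> matrix may exceed the
  maximum of its entries by a power of \<open>n\<close>, it never exceeds the first one on differences of such
  matrices. So the \<open>n\<close>-th amplification is an isometry (\<open>level_map_isometry\<close>). The target is the
  direct sum of all levels, which accommodates the \<open>n\<close>-th map for every \<open>n\<close>.

  There is no linear embedding, for cardinality reasons. An element of the target is
  determined by its values at the cells, hence by countably many functionals
  (\<open>target_space_eq_0I\<close>). A bounded functional on \<open>c\<^sub>0\<close> is nonzero at only countably many of the
  uncountably many atoms (\<open>countable_support_on_atoms\<close>), so that a bounded linear map into the
  target has to annihilate some atom.

  The linear notions of almost complete embedding both contain an isomorphic embedding at the first
  matrix level, so that the same two spaces separate the linear from the nonlinear notions.
\<close>

section \<open>Matrix norms\<close>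

lemma tuple_norm_cong: "(\<And>i. i < n \<Longrightarrow> \<xi> i = \<eta> i) \<Longrightarrow> tuple_norm n \<xi> = tuple_norm n \<eta>"
  by (simp add: tuple_norm_def cong: L2_set_cong_simp)

lemma matrix_norm_cong:
  "(\<And>i j. i < n \<Longrightarrow> j < n \<Longrightarrow> A i j = B i j) \<Longrightarrow> matrix_norm n A = matrix_norm n B"
  unfolding matrix_norm_def by (intro SUP_cong refl tuple_norm_cong sum.cong) auto

lemma matrix_norm_upper:
  assumes "tuple_norm n \<xi> \<le> 1"
  shows "tuple_norm n (\<lambda>i. \<Sum>j<n. blinfun_apply (A i j) (\<xi> j)) \<le> matrix_norm n A"
  unfolding matrix_norm_def by (rule cSUP_upper[OF _ bdd_above_matrix_norm]) (use assms in simp)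

lemma matrix_norm_least:
  assumes "\<And>\<xi>. tuple_norm n \<xi> \<le> 1 \<Longrightarrow>
    tuple_norm n (\<lambda>i. \<Sum>j<n. blinfun_apply (A i j) (\<xi> j)) \<le> B"
  shows "matrix_norm n A \<le> B"
  unfolding matrix_norm_def
proof (rule cSUP_least)
  show "{\<xi> :: nat \<Rightarrow> 'a. tuple_norm n \<xi> \<le> 1} \<noteq> {}"
    by (auto simp: tuple_norm_def L2_set_def intro!: exI[of _ "\<lambda>_. 0"])
qed (use assms in auto)

lemma matrix_norm_nonneg: "0 \<le> matrix_norm n A"
proof -
  have "0 \<le> tuple_norm n (\<lambda>i. \<Sum>j<n. blinfun_apply (A i j) 0)"
    by (simp add: tuple_norm_def)
  also have "\<dots> \<le> matrix_norm n A"
    by (rule matrix_norm_upper) (simp add: tuple_norm_def L2_set_def)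
  finally show ?thesis .
qed

lemma matrix_norm_bound:
  "tuple_norm n (\<lambda>i. \<Sum>j<n. blinfun_apply (A i j) (\<xi> j)) \<le> matrix_norm n A * tuple_norm n \<xi>"
proof (cases "tuple_norm n \<xi> = 0")
  case True
  then have "\<xi> j = 0" if "j < n" for j
    using that by (simp add: tuple_norm_def L2_set_eq_0_iff)
  then show ?thesis
    by (simp add: True) (simp add: tuple_norm_def L2_set_def)
next
  case False
  define s where "s = tuple_norm n \<xi>"
  have s: "s > 0"
    using False L2_set_nonneg unfolding s_def tuple_norm_def by (metis less_eq_real_def)
  have scale: "tuple_norm n (\<lambda>i. r *\<^sub>R \<eta> i) = r * tuple_norm n \<eta>" if "0 \<le> r" for r and \<eta> :: "nat \<Rightarrow> 'a"
    using that by (simp add: tuple_norm_def L2_set_right_distrib)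
  have "tuple_norm n (\<lambda>i. \<Sum>j<n. blinfun_apply (A i j) (inverse s *\<^sub>R \<xi> j)) \<le> matrix_norm n A"
    by (rule matrix_norm_upper) (use s in \<open>simp add: scale flip: s_def\<close>)
  also have "(\<lambda>i. \<Sum>j<n. blinfun_apply (A i j) (inverse s *\<^sub>R \<xi> j))
      = (\<lambda>i. inverse s *\<^sub>R (\<Sum>j<n. blinfun_apply (A i j) (\<xi> j)))"
    by (simp add: blinfun.scaleR_right scaleR_sum_right)
  finally show ?thesis
    using s by (simp add: scale field_simps flip: s_def)
qed

lemma norm_entry_le_matrix_norm:
  assumes "i < n" "j < n"
  shows "norm (A i j) \<le> matrix_norm n A"
proof (rule norm_blinfun_bound[OF matrix_norm_nonneg])
  fix x :: 'a
  define \<xi> where "\<xi> = (\<lambda>l. if l = j then x else 0)"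
  have "(\<Sum>l<n. (norm (\<xi> l))\<^sup>2) = (\<Sum>l<n. if l = j then (norm x)\<^sup>2 else 0)"
    by (intro sum.cong) (auto simp: \<xi>_def)
  then have "tuple_norm n \<xi> = norm x"
    using assms by (simp add: tuple_norm_def L2_set_def)
  moreover have "(\<lambda>i. \<Sum>l<n. blinfun_apply (A i l) (\<xi> l)) = (\<lambda>i. blinfun_apply (A i j) x)"
    using assms by (simp add: \<xi>_def if_distrib sum.delta cong: if_cong)
  ultimately have "tuple_norm n (\<lambda>i. blinfun_apply (A i j) x) \<le> matrix_norm n A * norm x"
    using matrix_norm_bound[of n A \<xi>] by simp
  then show "norm (blinfun_apply (A i j) x) \<le> matrix_norm n A * norm x"
    using member_le_L2_set[of "{..<n}" i "\<lambda>i. norm (blinfun_apply (A i j) x)"] assms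
    by (simp add: tuple_norm_def)
qed

lemma matrix_norm_1: "matrix_norm 1 A = norm (A 0 0)"
proof (rule antisym)
  show "matrix_norm 1 A \<le> norm (A 0 0)"
  proof (rule matrix_norm_least)
    fix \<xi> :: "nat \<Rightarrow> 'a"
    assume "tuple_norm 1 \<xi> \<le> 1"
    then have "norm (\<xi> 0) \<le> 1"
      by (simp add: tuple_norm_def lessThan_Suc)
    then have "norm (A 0 0) * norm (\<xi> 0) \<le> norm (A 0 0)"
      by (simp add: mult_left_le)
    then show "tuple_norm 1 (\<lambda>i. \<Sum>j<1. blinfun_apply (A i j) (\<xi> j)) \<le> norm (A 0 0)"
      using norm_blinfun[of "A 0 0" "\<xi> 0"] by (simp add: tuple_norm_def lessThan_Suc)
  qed
qed (simp add: norm_entry_le_matrix_norm)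

lemma matrix_dist_eq_0_imp_eq:
  assumes "A \<in> matrices n X" "B \<in> matrices n X" "matrix_dist n A B \<le> 0"
  shows "A = B"
proof (intro ext)
  fix i j
  show "A i j = B i j"
  proof (cases "i < n \<and> j < n")
    case True
    then have "norm (A i j - B i j) \<le> 0"
      using norm_entry_le_matrix_norm[of i n j "\<lambda>i j. A i j - B i j"] assms(3)
      unfolding matrix_dist_def by linarith
    then show ?thesis by simp
  next
    case False
    then show ?thesis using assms(1,2) unfolding matrices_def by force
  qed
qed

section \<open>Coordinates in the Hilbert space of square-summable families\<close>

lemma summable_Rep_ell2: "(\<lambda>i. (cmod (Rep_ell2 x i))\<^sup>2) summable_on UNIV"
  using Rep_ell2 by auto

lemma norm_ell2_power2: "(norm x)\<^sup>2 = (\<Sum>\<^sub>\<infinity>i. (cmod (Rep_ell2 x i))\<^sup>2)"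
  by (simp add: power2_norm_eq_inner inner_ell2_self)

lemma cmod_Rep_ell2_le_norm: "cmod (Rep_ell2 x t) \<le> norm x"
proof -
  have "(cmod (Rep_ell2 x t))\<^sup>2 \<le> (norm x)\<^sup>2"
    unfolding norm_ell2_power2
    using finite_sum_le_infsum[OF summable_Rep_ell2, of "{t}" x] by simp
  then show ?thesis by (simp add: power2_le_iff_abs_le)
qed

lemma Rep_ell2_sum: "Rep_ell2 (\<Sum>j\<in>J. x j) t = (\<Sum>j\<in>J. Rep_ell2 (x j) t)"
  by (induction J rule: infinite_finite_induct) (simp_all add: zero_ell2.rep_eq plus_ell2.rep_eq)

lemma bounded_linear_Rep_ell2: "bounded_linear (\<lambda>x. Rep_ell2 x t)"
  by (rule bounded_linear_intro[where K = 1])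
     (simp_all add: plus_ell2.rep_eq scaleR_ell2.rep_eq scaleR_conv_of_real cmod_Rep_ell2_le_norm)

lift_definition ket :: "'i \<Rightarrow> 'i ell2" is "\<lambda>t i. if i = t then 1 else 0"
proof -
  fix t :: 'i
  have "(\<lambda>i. (cmod (if i = t then 1 else 0))\<^sup>2) summable_on {t}" by simp
  then show "(\<lambda>i. (cmod (if i = t then 1 else 0))\<^sup>2) summable_on UNIV"
    by (rule summable_on_cong_neutral[THEN iffD1, rotated -1]) auto
qed

lemma norm_ket: "norm (ket t) = 1"
proof -
  have "(norm (ket t))\<^sup>2 = (\<Sum>\<^sub>\<infinity>i\<in>{t}. (1::real))"
    unfolding norm_ell2_power2 by (rule infsum_cong_neutral) (auto simp: ket.rep_eq)
  then show ?thesis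
    using norm_ge_zero[of "ket t"] by (simp add: power2_eq_1_iff del: norm_ge_zero)
qed

lemma norm_scaleC_ket: "norm (c *\<^sub>C ket t) = cmod c"
  by (simp add: norm_scaleC norm_ket)

lemma infsum_finite_sum_swap:
  fixes f :: "'a \<Rightarrow> 'b \<Rightarrow> real"
  assumes "finite S" "\<And>i. i \<in> S \<Longrightarrow> f i summable_on A"
  shows "(\<lambda>t. \<Sum>i\<in>S. f i t) summable_on A \<and>
    (\<Sum>\<^sub>\<infinity>t\<in>A. \<Sum>i\<in>S. f i t) = (\<Sum>i\<in>S. infsum (f i) A)"
  using assms by (induction S) (auto simp: summable_on_add infsum_add)

section \<open>Diagonal operators\<close>

definition entry :: "('i ell2 \<Rightarrow>\<^sub>L 'i ell2) \<Rightarrow> 'i \<Rightarrow> complex"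
  where "entry T t = Rep_ell2 (blinfun_apply T (ket t)) t"

definition diagonal :: "('i ell2 \<Rightarrow>\<^sub>L 'i ell2) \<Rightarrow> bool"
  where "diagonal T \<longleftrightarrow> (\<forall>x t. Rep_ell2 (blinfun_apply T x) t = entry T t * Rep_ell2 x t)"

lift_definition multiply :: "('i \<Rightarrow> complex) \<Rightarrow> 'i ell2 \<Rightarrow> 'i ell2"
  is "\<lambda>a f i. if bounded (range a) then a i * f i else 0"
proof -
  fix a f :: "'i \<Rightarrow> complex"
  assume f: "(\<lambda>i. (cmod (f i))\<^sup>2) summable_on UNIV"
  show "(\<lambda>i. (cmod (if bounded (range a) then a i * f i else 0))\<^sup>2) summable_on UNIV"
  proof (cases "bounded (range a)")
    case True
    then obtain K where K: "cmod (a i) \<le> K" for i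
      by (auto simp: bounded_iff)
    have "(\<lambda>i. (cmod (a i * f i))\<^sup>2) summable_on UNIV"
    proof (rule summable_on_comparison_test)
      show "(\<lambda>i. K\<^sup>2 * (cmod (f i))\<^sup>2) summable_on UNIV"
        by (intro summable_on_cmult_right f)
      show "(cmod (a i * f i))\<^sup>2 \<le> K\<^sup>2 * (cmod (f i))\<^sup>2" for i
        unfolding norm_mult power_mult_distrib
        by (intro mult_right_mono power_mono K) auto
    qed simp
    then show ?thesis using True by simp
  qed simp
qed

definition diag :: "('i \<Rightarrow> complex) \<Rightarrow> 'i ell2 \<Rightarrow>\<^sub>L 'i ell2"
  where "diag a = Blinfun (multiply a)"

lemma norm_ell2_le_coordinatewise:
  assumes "0 \<le> K" "\<And>t. cmod (Rep_ell2 y t) \<le> K * cmod (Rep_ell2 x t)"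
  shows "norm y \<le> K * norm x"
proof -
  have "(norm y)\<^sup>2 \<le> (\<Sum>\<^sub>\<infinity>t. K\<^sup>2 * (cmod (Rep_ell2 x t))\<^sup>2)"
    unfolding norm_ell2_power2
  proof (rule infsum_mono)
    show "(cmod (Rep_ell2 y t))\<^sup>2 \<le> K\<^sup>2 * (cmod (Rep_ell2 x t))\<^sup>2" for t
      using power_mono[OF assms(2), of t 2] by (simp add: power_mult_distrib)
  qed (intro summable_on_cmult_right summable_Rep_ell2)+
  also have "\<dots> = (K * norm x)\<^sup>2"
    by (simp add: infsum_cmult_right' power_mult_distrib norm_ell2_power2)
  finally show ?thesis
    using assms(1) by (simp add: power2_le_iff_abs_le)
qed

lemma diag_apply:
  assumes "bounded (range a)"
  shows "Rep_ell2 (blinfun_apply (diag a) x) t = a t * Rep_ell2 x t"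
proof -
  obtain K where K: "0 \<le> K" "cmod (a i) \<le> K" for i
    using assms by (auto simp: bounded_iff intro: order_trans[OF norm_ge_zero])
  have "bounded_linear (multiply a)"
  proof (rule bounded_linear_intro[where K = K])
    show "norm (multiply a x) \<le> norm x * K" for x
      unfolding mult.commute[of "norm x"]
      by (rule norm_ell2_le_coordinatewise)
         (use K assms in \<open>auto simp: multiply.rep_eq norm_mult mult_right_mono\<close>)
  qed (auto intro!: Rep_ell2_inject[THEN iffD1]
        simp: fun_eq_iff multiply.rep_eq plus_ell2.rep_eq scaleR_ell2.rep_eq algebra_simps)
  then show ?thesis
    using assms by (simp add: diag_def bounded_linear_Blinfun_apply multiply.rep_eq)
qed

lemma entry_diag: "bounded (range a) \<Longrightarrow> entry (diag a) = a"
  by (simp add: entry_def fun_eq_iff diag_apply ket.rep_eq)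

lemma diagonal_diag: "bounded (range a) \<Longrightarrow> diagonal (diag a)"
  by (simp add: diagonal_def entry_diag diag_apply)

lemma entry_add: "entry (S + T) t = entry S t + entry T t"
  by (simp add: entry_def blinfun.add_left plus_ell2.rep_eq)

lemma entry_diff: "entry (S - T) t = entry S t - entry T t"
  by (simp add: entry_def blinfun.diff_left minus_ell2.rep_eq)

lemma entry_scaleC: "entry (c *\<^sub>C T) t = c * entry T t"
  by (simp add: entry_def scaleC_blinfun.rep_eq scaleC_ell2.rep_eq)

lemma entry_zero: "entry 0 t = 0"
  by (simp add: entry_def zero_ell2.rep_eq)

lemma bounded_linear_entry: "bounded_linear (\<lambda>T. entry T t)"
  unfolding entry_def
  by (intro bounded_linear_compose[OF bounded_linear_Rep_ell2] blinfun.bounded_linear_left)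

lemma cmod_entry_le_norm: "cmod (entry T t) \<le> norm T"
  using cmod_Rep_ell2_le_norm[of "blinfun_apply T (ket t)" t] norm_blinfun[of T "ket t"]
  by (simp add: entry_def norm_ket)

lemma bounded_entry: "bounded (range (entry T))"
  unfolding bounded_iff using cmod_entry_le_norm[of T] by blast

lemma norm_diagonal_le:
  assumes "diagonal T" "0 \<le> K" "\<And>t. cmod (entry T t) \<le> K"
  shows "norm T \<le> K"
proof (rule norm_blinfun_bound[OF assms(2)])
  show "norm (blinfun_apply T x) \<le> K * norm x" for x
    using assms by (intro norm_ell2_le_coordinatewise)
      (auto simp: diagonal_def norm_mult mult_right_mono)
qed

lemma diagonal_eqI:
  assumes "diagonal S" "diagonal T" "\<And>t. entry S t = entry T t"
  shows "S = T"
  using assms by (intro blinfun_eqI Rep_ell2_inject[THEN iffD1] ext) (simp add: diagonal_def)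

lemma diagonal_diff: "diagonal S \<Longrightarrow> diagonal T \<Longrightarrow> diagonal (S - T)"
  by (simp add: diagonal_def entry_diff blinfun.diff_left minus_ell2.rep_eq algebra_simps)

lemma closed_diagonal: "closed {T. diagonal T}"
proof -
  have "closed {T. Rep_ell2 (blinfun_apply T x) t = entry T t * Rep_ell2 x t}"
    for x :: "'a ell2" and t
    by (intro closed_Collect_eq continuous_intros
        bounded_linear.continuous_on[OF bounded_linear_Rep_ell2]
        bounded_linear.continuous_on[OF bounded_linear_entry])
  then show ?thesis
    unfolding diagonal_def by (intro closed_Collect_all)
qed

text \<open>Entries depend on a diagonal operator through a contraction, so a space of diagonal operators
  is closed once the condition on the entries is stable under uniform limits.\<close>

lemma operator_space_diagonalI:
  assumes zero: "P (\<lambda>_. 0)"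
    and add: "\<And>a b. P a \<Longrightarrow> P b \<Longrightarrow> P (\<lambda>t. a t + b t)"
    and scale: "\<And>c a. P a \<Longrightarrow> P (\<lambda>t. c * a t)"
    and uniform_limit: "\<And>a. (\<And>e. 0 < e \<Longrightarrow> \<exists>b. P b \<and> (\<forall>t. cmod (b t - a t) < e)) \<Longrightarrow> P a"
  shows "operator_space {T. diagonal T \<and> P (entry T)}" (is "operator_space ?X")
  unfolding operator_space_def
proof (intro conjI ballI allI)
  show "?X \<subseteq> bounded_operators"
    by (auto simp: bounded_operators_def diagonal_def scaleC_ell2.rep_eq
        intro!: Rep_ell2_inject[THEN iffD1])
  show "0 \<in> ?X"
    using zero by (simp add: diagonal_def zero_ell2.rep_eq entry_zero fun_eq_iff
        flip: entry_zero[abs_def])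
  show "S + T \<in> ?X" if "S \<in> ?X" "T \<in> ?X" for S T
    using that add[of "entry S" "entry T"] unfolding entry_add[abs_def, symmetric]
    by (auto simp: diagonal_def entry_add blinfun.add_left plus_ell2.rep_eq algebra_simps)
  show "c *\<^sub>C T \<in> ?X" if "T \<in> ?X" for c T
    using that scale[of "entry T" c] unfolding entry_scaleC[abs_def, symmetric]
    by (auto simp: diagonal_def entry_scaleC scaleC_blinfun.rep_eq scaleC_ell2.rep_eq)
  have "closure ?X \<subseteq> ?X"
  proof
    fix T assume T: "T \<in> closure ?X"
    have "closure ?X \<subseteq> {T. diagonal T}"
      by (rule closure_minimal[OF _ closed_diagonal]) auto
    moreover have "P (entry T)"
    proof (rule uniform_limit)
      fix e :: real assume "0 < e"
      then obtain S where S: "S \<in> ?X" "norm (S - T) < e"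
        using T unfolding closure_approachable dist_norm by blast
      have "cmod (entry S t - entry T t) < e" for t
        using cmod_entry_le_norm[of "S - T" t] S(2) by (simp add: entry_diff)
      then show "\<exists>b. P b \<and> (\<forall>t. cmod (b t - entry T t) < e)"
        using S(1) by blast
    qed
    ultimately show "T \<in> ?X" using T by blast
  qed
  then show "closed ?X"
    by (simp add: closure_subset_eq)
qed

subsection \<open>Matrices of diagonal operators\<close>

definition scalar_matrix_bound :: "nat \<Rightarrow> (nat \<Rightarrow> nat \<Rightarrow> complex) \<Rightarrow> real \<Rightarrow> bool"
  where "scalar_matrix_bound n m B \<longleftrightarrow>
    (\<forall>v. L2_set (\<lambda>i. cmod (\<Sum>j<n. m i j * v j)) {..<n} \<le> B * L2_set (\<lambda>j. cmod (v j)) {..<n})"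

lemma scalar_matrix_bound_zero: "0 \<le> B \<Longrightarrow> scalar_matrix_bound n (\<lambda>i j. 0) B"
  by (simp add: scalar_matrix_bound_def L2_set_0')

text \<open>The exponent \<open>2\<close> is not sharp, but any power of \<open>n\<close> is enough for what follows.\<close>

lemma scalar_matrix_bound_entrywise:
  assumes B: "0 \<le> B" and m: "\<And>i j. i < n \<Longrightarrow> j < n \<Longrightarrow> cmod (m i j) \<le> B / real n ^ 2"
  shows "scalar_matrix_bound n m B"
  unfolding scalar_matrix_bound_def
proof
  fix v :: "nat \<Rightarrow> complex"
  let ?L = "L2_set (\<lambda>j. cmod (v j)) {..<n}"
  have row: "cmod (\<Sum>j<n. m i j * v j) \<le> real n * (B / real n ^ 2 * ?L)" if "i < n" for i
  proof -
    have "cmod (\<Sum>j<n. m i j * v j) \<le> (\<Sum>j<n. B / real n ^ 2 * ?L)"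
    proof (rule sum_norm_le)
      fix j assume j: "j \<in> {..<n}"
      then have "cmod (v j) \<le> ?L"
        by (intro member_le_L2_set) auto
      then show "cmod (m i j * v j) \<le> B / real n ^ 2 * ?L"
        using m[OF that] j B unfolding norm_mult by (intro mult_mono) auto
    qed
    then show ?thesis by simp
  qed
  have "L2_set (\<lambda>i. cmod (\<Sum>j<n. m i j * v j)) {..<n} \<le> (\<Sum>i<n. cmod (\<Sum>j<n. m i j * v j))"
    by (rule L2_set_le_sum) simp
  also have "\<dots> \<le> (\<Sum>i<n. real n * (B / real n ^ 2 * ?L))"
    by (intro sum_mono row) simp
  also have "\<dots> \<le> B * ?L"
    using B by (cases "n = 0") (auto simp: power2_eq_square)
  finally show "L2_set (\<lambda>i. cmod (\<Sum>j<n. m i j * v j)) {..<n} \<le> B * ?L" .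
qed

text \<open>A matrix of diagonal operators is, after reordering the basis, the direct sum of the scalar
  matrices formed by its entries, so that its norm is the supremum of their norms.\<close>

lemma matrix_norm_diagonal_le_iff:
  assumes diag: "\<And>i j. i < n \<Longrightarrow> j < n \<Longrightarrow> diagonal (M i j)" and B: "0 \<le> B"
  shows "matrix_norm n M \<le> B \<longleftrightarrow> (\<forall>t. scalar_matrix_bound n (\<lambda>i j. entry (M i j) t) B)"
proof
  assume M: "matrix_norm n M \<le> B"
  show "\<forall>t. scalar_matrix_bound n (\<lambda>i j. entry (M i j) t) B"
    unfolding scalar_matrix_bound_def
  proof (intro allI)
    fix t :: 'a and v :: "nat \<Rightarrow> complex"
    define \<xi> where "\<xi> = (\<lambda>j. v j *\<^sub>C ket t)"
    have "Rep_ell2 (\<Sum>j<n. blinfun_apply (M i j) (\<xi> j)) t = (\<Sum>j<n. entry (M i j) t * v j)"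
      if "i < n" for i
      using diag[OF that]
      by (simp add: Rep_ell2_sum diagonal_def \<xi>_def scaleC_ell2.rep_eq ket.rep_eq)
    then have "L2_set (\<lambda>i. cmod (\<Sum>j<n. entry (M i j) t * v j)) {..<n}
        \<le> tuple_norm n (\<lambda>i. \<Sum>j<n. blinfun_apply (M i j) (\<xi> j))"
      unfolding tuple_norm_def by (intro L2_set_mono) (metis cmod_Rep_ell2_le_norm lessThan_iff, simp)
    also have "\<dots> \<le> matrix_norm n M * tuple_norm n \<xi>"
      by (rule matrix_norm_bound)
    also have "\<dots> \<le> B * tuple_norm n \<xi>"
      by (intro mult_right_mono M) (simp add: tuple_norm_def)
    also have "tuple_norm n \<xi> = L2_set (\<lambda>j. cmod (v j)) {..<n}"
      by (simp add: tuple_norm_def \<xi>_def norm_scaleC_ket)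
    finally show "L2_set (\<lambda>i. cmod (\<Sum>j<n. entry (M i j) t * v j)) {..<n}
        \<le> B * L2_set (\<lambda>j. cmod (v j)) {..<n}" .
  qed
next
  assume bound: "\<forall>t. scalar_matrix_bound n (\<lambda>i j. entry (M i j) t) B"
  show "matrix_norm n M \<le> B"
  proof (rule matrix_norm_least)
    fix \<xi> :: "nat \<Rightarrow> 'a ell2" assume \<xi>: "tuple_norm n \<xi> \<le> 1"
    let ?\<eta> = "\<lambda>i. \<Sum>j<n. blinfun_apply (M i j) (\<xi> j)"
    have tuple2: "(tuple_norm n \<zeta>)\<^sup>2 = (\<Sum>\<^sub>\<infinity>t. \<Sum>i<n. (cmod (Rep_ell2 (\<zeta> i) t))\<^sup>2)"
      and summ: "(\<lambda>t. \<Sum>i<n. (cmod (Rep_ell2 (\<zeta> i) t))\<^sup>2) summable_on UNIV" for \<zeta> :: "nat \<Rightarrow> 'a ell2"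
      using infsum_finite_sum_swap[of "{..<n}" "\<lambda>i t. (cmod (Rep_ell2 (\<zeta> i) t))\<^sup>2" UNIV]
      by (simp_all add: tuple_norm_def L2_set_def sum_nonneg infsum_nonneg norm_ell2_power2
          summable_Rep_ell2)
    have "(tuple_norm n ?\<eta>)\<^sup>2 \<le> (\<Sum>\<^sub>\<infinity>t. B\<^sup>2 * (\<Sum>i<n. (cmod (Rep_ell2 (\<xi> i) t))\<^sup>2))"
      unfolding tuple2
    proof (rule infsum_mono[OF summ summable_on_cmult_right[OF summ]])
      fix t
      let ?v = "\<lambda>j. Rep_ell2 (\<xi> j) t"
      have "(\<Sum>i<n. (cmod (Rep_ell2 (?\<eta> i) t))\<^sup>2)
          = (L2_set (\<lambda>i. cmod (\<Sum>j<n. entry (M i j) t * ?v j)) {..<n})\<^sup>2"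
        using diag by (simp add: L2_set_def sum_nonneg Rep_ell2_sum diagonal_def)
      also have "\<dots> \<le> (B * L2_set (\<lambda>j. cmod (?v j)) {..<n})\<^sup>2"
        using bound unfolding scalar_matrix_bound_def by (intro power_mono) auto
      also have "\<dots> = B\<^sup>2 * (\<Sum>i<n. (cmod (?v i))\<^sup>2)"
        by (simp add: power_mult_distrib L2_set_def sum_nonneg)
      finally show "(\<Sum>i<n. (cmod (Rep_ell2 (?\<eta> i) t))\<^sup>2) \<le> B\<^sup>2 * (\<Sum>i<n. (cmod (?v i))\<^sup>2)" .
    qed
    also have "\<dots> = (B * tuple_norm n \<xi>)\<^sup>2"
      by (simp add: infsum_cmult_right' tuple2 power_mult_distrib)
    also have "\<dots> \<le> B\<^sup>2"
      using \<xi> B by (intro power_mono mult_left_le) (auto simp: tuple_norm_def)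
    finally show "tuple_norm n ?\<eta> \<le> B"
      using B by (simp add: power2_le_iff_abs_le)
  qed
qed

section \<open>Comparing the notions of embedding\<close>

lemma operator_space_diff:
  assumes "operator_space X" "S \<in> X" "T \<in> X"
  shows "S - T \<in> X"
proof -
  have "(- 1) *\<^sub>C T = - T"
    using scaleC_of_real[of "- 1" T] by simp
  then have "- T \<in> X"
    using assms unfolding operator_space_def by metis
  then have "S + (- T) \<in> X"
    using assms unfolding operator_space_def by blast
  then show ?thesis by simp
qed

lemma real_linear_on_zero:
  assumes "real_linear_on X f" "0 \<in> X"
  shows "f 0 = 0"
  using assms unfolding real_linear_on_def by (metis scaleR_zero_left)

lemma real_linear_on_diff:
  assumes "operator_space X" "real_linear_on X f" "S \<in> X" "T \<in> X"
  shows "f (S - T) = f S - f T"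
  using assms operator_space_diff[of X S T] unfolding real_linear_on_def
  by (metis add_diff_cancel_right' diff_add_cancel)

lemma distortion_isometry_le_1:
  assumes "isometry_on A d d' g"
  shows "distortion A d d' g \<le> 1"
  unfolding distortion_def
proof (rule cInf_lower)
  show "1 \<in> {D. D > 0 \<and> (\<exists>r>0. \<forall>x\<in>A. \<forall>y\<in>A. r * d x y \<le> d' (g x) (g y) \<and> d' (g x) (g y) \<le> D * r * d x y)}"
    using assms unfolding isometry_on_def by (auto intro!: exI[of _ 1])
qed (auto intro!: bdd_belowI[of _ 0])

lemma almost_completely_isometrically_imp_lipschitzly_embeds:
  assumes "almost_completely_isometrically_embeds X Y"
  shows "almost_completely_lipschitzly_embeds X Y"
proof -
  obtain f where f: "almost_complete_isometric_embedding X Y f"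
    using assms unfolding almost_completely_isometrically_embeds_def by blast
  have "almost_complete_lipschitz_embedding X Y f"
    unfolding almost_complete_lipschitz_embedding_def
  proof (intro exI[of _ "1::real"] conjI allI impI)
    fix n :: nat assume "n \<ge> 1"
    then have XY: "f n \<in> X \<rightarrow> Y"
      and iso: "isometry_on (matrices n X) (matrix_dist n) (matrix_dist n) (amplification n (f n))"
      using f unfolding almost_complete_isometric_embedding_def by auto
    show "f n \<in> X \<rightarrow> Y" by (fact XY)
    have "inj_on (amplification n (f n)) (matrices n X)"
    proof (rule inj_onI)
      fix A B assume AB: "A \<in> matrices n X" "B \<in> matrices n X"
        and eq: "amplification n (f n) A = amplification n (f n) B"
      have "matrix_dist n A B = matrix_dist n (amplification n (f n) B) (amplification n (f n) B)"
        using iso AB eq unfolding isometry_on_def by metis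
      also have "\<dots> = matrix_dist n B B"
        using iso AB unfolding isometry_on_def by metis
      also have "\<dots> \<le> 0"
        unfolding matrix_dist_def
        by (rule matrix_norm_least) (simp add: tuple_norm_def L2_set_def)
      finally show "A = B"
        using matrix_dist_eq_0_imp_eq AB by blast
    qed
    then show "lipschitz_embedding (matrices n X) (matrix_dist n) (matrix_dist n) (amplification n (f n))"
      using iso unfolding lipschitz_embedding_def isometry_on_def
      by (auto intro!: exI[of _ 1])
    show "distortion (matrices n X) (matrix_dist n) (matrix_dist n) (amplification n (f n)) \<le> 1"
      by (rule distortion_isometry_le_1[OF iso])
  qed simp
  then show ?thesis
    unfolding almost_completely_lipschitzly_embeds_def by blast
qed

lemma almost_completely_real_isomorphically_imp_lipschitzly_embeds:
  assumes X: "operator_space X" and emb: "almost_completely_real_isomorphically_embeds X Y"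
  shows "almost_completely_lipschitzly_embeds X Y"
proof -
  obtain f where f: "almost_complete_real_isomorphic_embedding X Y f"
    using emb unfolding almost_completely_real_isomorphically_embeds_def by blast
  then obtain D where D: "D > 0" and fD: "\<And>n. n \<ge> 1 \<Longrightarrow> f n \<in> X \<rightarrow> Y \<and> real_linear_on X (f n) \<and>
      isomorphic_embedding (matrices n X) (matrix_norm n) (matrix_norm n) (amplification n (f n)) \<and>
      distortion (matrices n X) (matrix_dist n) (matrix_dist n) (amplification n (f n)) \<le> D"
    unfolding almost_complete_real_isomorphic_embedding_def by blast
  have "almost_complete_lipschitz_embedding X Y f"
    unfolding almost_complete_lipschitz_embedding_def
  proof (intro exI[of _ D] conjI allI impI D)
    fix n :: nat assume n: "n \<ge> 1"
    let ?M = "matrices n X" and ?g = "amplification n (f n)"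
    have lin: "real_linear_on X (f n)" using fD[OF n] by blast
    obtain C c where C: "\<And>A. A \<in> ?M \<Longrightarrow> matrix_norm n (?g A) \<le> C * matrix_norm n A"
      and c: "c > 0" "\<And>A. A \<in> ?M \<Longrightarrow> c * matrix_norm n A \<le> matrix_norm n (?g A)"
      using fD[OF n] unfolding isomorphic_embedding_def by blast
    have diff: "(\<lambda>i j. A i j - B i j) \<in> ?M"
      "matrix_dist n (?g A) (?g B) = matrix_norm n (?g (\<lambda>i j. A i j - B i j))"
      if "A \<in> ?M" "B \<in> ?M" for A B
    proof -
      have AB: "A i j \<in> X" "B i j \<in> X" if "i < n" "j < n" for i j
        using \<open>A \<in> ?M\<close> \<open>B \<in> ?M\<close> that unfolding matrices_def by force+
      have AB0: "A i j = 0" "B i j = 0" if "\<not> (i < n \<and> j < n)" for i j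
        using \<open>A \<in> ?M\<close> \<open>B \<in> ?M\<close> that unfolding matrices_def by force+
      show "(\<lambda>i j. A i j - B i j) \<in> ?M"
        using AB AB0 operator_space_diff[OF X] by (simp add: matrices_def)
      show "matrix_dist n (?g A) (?g B) = matrix_norm n (?g (\<lambda>i j. A i j - B i j))"
        unfolding matrix_dist_def
        by (rule matrix_norm_cong) (simp add: amplification_def real_linear_on_diff[OF X lin] AB)
    qed
    have upper: "matrix_dist n (?g A) (?g B) \<le> C * matrix_dist n A B"
      if "A \<in> ?M" "B \<in> ?M" for A B
      using C diff[OF that] by (simp add: matrix_dist_def)
    have lower: "matrix_dist n A B \<le> inverse c * matrix_dist n (?g A) (?g B)"
      if "A \<in> ?M" "B \<in> ?M" for A B
      using c diff[OF that] by (simp add: matrix_dist_def field_simps)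
    have "inj_on ?g ?M"
    proof (rule inj_onI)
      fix A B assume AB: "A \<in> ?M" "B \<in> ?M" "?g A = ?g B"
      have "matrix_dist n (?g B) (?g B) \<le> 0"
        unfolding matrix_dist_def
        by (rule matrix_norm_least) (simp add: tuple_norm_def L2_set_def)
      then have "matrix_dist n A B \<le> 0"
        using lower[OF AB(1,2)] c(1) AB(3)
        by (smt (verit) mult_nonneg_nonpos positive_imp_inverse_positive)
      then show "A = B"
        using matrix_dist_eq_0_imp_eq AB by blast
    qed
    then show "lipschitz_embedding ?M (matrix_dist n) (matrix_dist n) ?g"
      using upper lower unfolding lipschitz_embedding_def by blast
  qed (use fD in auto)
  then show ?thesis
    unfolding almost_completely_lipschitzly_embeds_def by blast
qed

text \<open>Both linear notions specialise, at the first matrix level, to an isomorphic embedding of the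
  underlying Banach spaces.\<close>

lemma almost_completely_real_isomorphically_imp_real_isomorphically_embeds:
  assumes "almost_completely_real_isomorphically_embeds X Y"
  shows "real_isomorphically_embeds X Y"
proof -
  obtain f where f: "f \<in> X \<rightarrow> Y" "real_linear_on X f"
    "isomorphic_embedding (matrices 1 X) (matrix_norm 1) (matrix_norm 1) (amplification 1 f)"
    using assms unfolding almost_completely_real_isomorphically_embeds_def
      almost_complete_real_isomorphic_embedding_def by blast
  define single :: "('a \<Rightarrow>\<^sub>L 'a) \<Rightarrow> nat \<Rightarrow> nat \<Rightarrow> 'a \<Rightarrow>\<^sub>L 'a"
    where "single T = (\<lambda>i j. if i < 1 \<and> j < 1 then T else 0)" for T
  have "single T \<in> matrices 1 X" if "T \<in> X" for T
    using that by (simp add: single_def matrices_def)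
  moreover have "matrix_norm 1 (single T) = norm T"
    "matrix_norm 1 (amplification 1 f (single T)) = norm (f T)" for T
    unfolding matrix_norm_1 by (simp_all add: single_def amplification_def)
  ultimately have "isomorphic_embedding X norm norm f"
    using f(3) unfolding isomorphic_embedding_def by metis
  then show ?thesis
    using f unfolding real_isomorphically_embeds_def by blast
qed

lemma almost_completely_real_linearly_isometrically_imp_real_isomorphically_embeds:
  assumes X: "0 \<in> X" and emb: "almost_completely_real_linearly_isometrically_embeds X Y"
  shows "real_isomorphically_embeds X Y"
proof -
  obtain f where f: "f \<in> X \<rightarrow> Y" "real_linear_on X f"
    and iso: "isometry_on (matrices 1 X) (matrix_dist 1) (matrix_dist 1) (amplification 1 f)"
    using emb unfolding almost_completely_real_linearly_isometrically_embeds_def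
      almost_complete_isometric_embedding_def by blast
  have "norm (f T) = norm T" if "T \<in> X" for T
  proof -
    define A :: "nat \<Rightarrow> nat \<Rightarrow> 'a \<Rightarrow>\<^sub>L 'a" where "A = (\<lambda>i j. if i < 1 \<and> j < 1 then T else 0)"
    have "A \<in> matrices 1 X" "(\<lambda>i j. 0) \<in> matrices 1 X"
      using that X by (simp_all add: A_def matrices_def)
    then have "matrix_dist 1 (amplification 1 f A) (amplification 1 f (\<lambda>i j. 0))
        = matrix_dist 1 A (\<lambda>i j. 0)"
      using iso unfolding isometry_on_def by blast
    then show ?thesis
      unfolding matrix_dist_def matrix_norm_1
      by (simp add: A_def amplification_def real_linear_on_zero[OF f(2) X])
  qed
  then have "isomorphic_embedding X norm norm f"
    unfolding isomorphic_embedding_def by (auto intro!: exI[of _ 1])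
  then show ?thesis
    using f unfolding real_isomorphically_embeds_def by blast
qed

section \<open>A Lipschitz lifting for functions vanishing at infinity\<close>

definition vanishes_at_infinity :: "('i \<Rightarrow> complex) \<Rightarrow> bool"
  where "vanishes_at_infinity a \<longleftrightarrow> (\<forall>e>0. finite {t. e \<le> cmod (a t)})"

text \<open>Inserting \<open>0\<close> turns the supremum into that of the positive part, and gives the empty set
  the value \<open>0\<close>.\<close>

definition sup_pos :: "('i \<Rightarrow> real) \<Rightarrow> 'i set \<Rightarrow> real"
  where "sup_pos a S = Sup (insert 0 (a ` S))"

text \<open>This is the lifting of Aharoni and Lindenstrauss: \<open>a\<close> is replaced by a function on a family
  of sets, from which its value at \<open>t\<close> is recovered as the limit along sets that shrink to \<open>t\<close>.
  It is Lipschitz but, because of the suprema, not linear.\<close>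

definition lift_on :: "('i \<Rightarrow> complex) \<Rightarrow> 'i set \<Rightarrow> complex"
  where "lift_on a S =
    Complex (sup_pos (\<lambda>t. Re (a t)) S - sup_pos (\<lambda>t. - Re (a t)) S)
            (sup_pos (\<lambda>t. Im (a t)) S - sup_pos (\<lambda>t. - Im (a t)) S)"

lemma sup_pos_le_add:
  assumes b: "bdd_above (b ` S)" and ab: "\<And>t. t \<in> S \<Longrightarrow> a t \<le> b t + d" and d: "0 \<le> d"
  shows "sup_pos a S \<le> sup_pos b S + d"
  unfolding sup_pos_def
proof (rule cSup_least)
  fix y assume y: "y \<in> insert 0 (a ` S)"
  have bdd: "bdd_above (insert 0 (b ` S))" using b by simp
  show "y \<le> Sup (insert 0 (b ` S)) + d"
  proof (cases "y = 0")
    case True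
    then show ?thesis using cSup_upper[OF _ bdd, of 0] d by simp
  next
    case False
    then obtain t where t: "t \<in> S" "y = a t" using y by blast
    then show ?thesis using cSup_upper[OF _ bdd, of "b t"] ab[of t] by simp
  qed
qed simp

lemma sup_pos_diff_le:
  assumes "bdd_above (a ` S)" "bdd_above (b ` S)" "0 \<le> d" "\<And>t. t \<in> S \<Longrightarrow> \<bar>a t - b t\<bar> \<le> d"
  shows "\<bar>sup_pos a S - sup_pos b S\<bar> \<le> d"
proof -
  have "sup_pos a S \<le> sup_pos b S + d"
    by (rule sup_pos_le_add[OF assms(2) _ assms(3)]) (use assms(4) in force)
  moreover have "sup_pos b S \<le> sup_pos a S + d"
    by (rule sup_pos_le_add[OF assms(1) _ assms(3)]) (use assms(4) in force)
  ultimately show ?thesis by linarith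
qed

text \<open>Four suprema, each of them nonexpansive.\<close>

lemma lift_on_lipschitz:
  assumes a: "bounded (range a)" and b: "bounded (range b)"
    and d: "0 \<le> d" "\<And>t. t \<in> S \<Longrightarrow> cmod (a t - b t) \<le> d"
  shows "cmod (lift_on a S - lift_on b S) \<le> 4 * d"
proof -
  have bdd: "bdd_above ((\<lambda>t. Re (c t)) ` S)" "bdd_above ((\<lambda>t. - Re (c t)) ` S)"
    "bdd_above ((\<lambda>t. Im (c t)) ` S)" "bdd_above ((\<lambda>t. - Im (c t)) ` S)"
    if c: "bounded (range c)" for c :: "'a \<Rightarrow> complex"
  proof -
    obtain K where "\<And>t. cmod (c t) \<le> K"
      using c unfolding bounded_iff by blast
    then have "\<bar>Re (c t)\<bar> \<le> K" "\<bar>Im (c t)\<bar> \<le> K" for t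
      using abs_Re_le_cmod abs_Im_le_cmod order_trans by blast+
    then show "bdd_above ((\<lambda>t. Re (c t)) ` S)" "bdd_above ((\<lambda>t. - Re (c t)) ` S)"
      "bdd_above ((\<lambda>t. Im (c t)) ` S)" "bdd_above ((\<lambda>t. - Im (c t)) ` S)"
      by (auto intro!: bdd_aboveI2[where M = K] simp: abs_le_iff)
  qed
  have parts: "\<bar>Re (a t) - Re (b t)\<bar> \<le> d" "\<bar>Im (a t) - Im (b t)\<bar> \<le> d" if "t \<in> S" for t
    using d(2)[OF that] abs_Re_le_cmod[of "a t - b t"] abs_Im_le_cmod[of "a t - b t"] by auto
  have "\<bar>sup_pos (\<lambda>t. Re (a t)) S - sup_pos (\<lambda>t. Re (b t)) S\<bar> \<le> d"
    by (rule sup_pos_diff_le[OF bdd(1)[OF a] bdd(1)[OF b] d(1)]) (use parts in force)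
  moreover have "\<bar>sup_pos (\<lambda>t. - Re (a t)) S - sup_pos (\<lambda>t. - Re (b t)) S\<bar> \<le> d"
    by (rule sup_pos_diff_le[OF bdd(2)[OF a] bdd(2)[OF b] d(1)]) (use parts in force)
  moreover have "\<bar>sup_pos (\<lambda>t. Im (a t)) S - sup_pos (\<lambda>t. Im (b t)) S\<bar> \<le> d"
    by (rule sup_pos_diff_le[OF bdd(3)[OF a] bdd(3)[OF b] d(1)]) (use parts in force)
  moreover have "\<bar>sup_pos (\<lambda>t. - Im (a t)) S - sup_pos (\<lambda>t. - Im (b t)) S\<bar> \<le> d"
    by (rule sup_pos_diff_le[OF bdd(4)[OF a] bdd(4)[OF b] d(1)]) (use parts in force)
  ultimately show ?thesis
    using cmod_le[of "lift_on a S - lift_on b S"] by (simp add: lift_on_def)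
qed

lemma lift_on_single:
  assumes "t \<in> S"
  shows "lift_on (\<lambda>s. if s = t then z else 0) S = z"
proof -
  have "sup_pos (\<lambda>s. if s = t then x else 0) S = max x 0" for x
  proof -
    have "insert 0 ((\<lambda>s. if s = t then x else 0) ` S) = {0, x}" using assms by auto
    then show ?thesis by (simp add: sup_pos_def cSup_eq_Max max.commute)
  qed
  then have "sup_pos (\<lambda>s. Re (if s = t then z else 0)) S = max (Re z) 0"
    "sup_pos (\<lambda>s. - Re (if s = t then z else 0)) S = max (- Re z) 0"
    "sup_pos (\<lambda>s. Im (if s = t then z else 0)) S = max (Im z) 0"
    "sup_pos (\<lambda>s. - Im (if s = t then z else 0)) S = max (- Im z) 0"
    by (simp_all add: if_distrib[of Re] if_distrib[of Im] if_distrib[of uminus] cong: if_cong)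
  then show ?thesis
    unfolding lift_on_def by (auto simp: complex_eq_iff max_def)
qed

text \<open>The cells \<open>S k\<close> eventually avoid the finitely many points other than \<open>t\<close> where \<open>a\<close> is not
  small; on such a cell \<open>a\<close> is close to its restriction to \<open>t\<close>, whose lift is exact.\<close>

lemma lift_on_tendsto:
  assumes bdd: "bounded (range a)" and a: "vanishes_at_infinity a"
    and t: "\<And>k. t \<in> S k" and shrink: "\<And>s. s \<noteq> t \<Longrightarrow> eventually (\<lambda>k. s \<notin> S k) sequentially"
  shows "(\<lambda>k. lift_on a (S k)) \<longlonglongrightarrow> a t"
proof (rule tendstoI)
  fix e :: real assume e: "0 < e"
  define b where "b = (\<lambda>s. if s = t then a t else 0)"
  have b: "bounded (range b)"
    by (rule finite_imp_bounded, rule finite_subset[of _ "{0, a t}"]) (auto simp: b_def)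
  have "finite ({s. e / 5 \<le> cmod (a s)} - {t})"
    using a divide_pos_pos[OF e, of 5] unfolding vanishes_at_infinity_def
    by (intro finite_Diff) (blast intro: zero_less_numeral)
  then have "eventually (\<lambda>k. \<forall>s\<in>{s. e / 5 \<le> cmod (a s)} - {t}. s \<notin> S k) sequentially"
    by (rule eventually_ball_finite) (use shrink in blast)
  then show "eventually (\<lambda>k. dist (lift_on a (S k)) (a t) < e) sequentially"
  proof eventually_elim
    case (elim k)
    have "cmod (lift_on a (S k) - lift_on b (S k)) \<le> 4 * (e / 5)"
    proof (rule lift_on_lipschitz[OF bdd b])
      fix s assume "s \<in> S k"
      then have "s = t \<or> cmod (a s) < e / 5" using elim by force
      then show "cmod (a s - b s) \<le> e / 5" using e by (auto simp: b_def)
    qed (use e in simp)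
    also have "lift_on b (S k) = a t"
      unfolding b_def by (rule lift_on_single[OF t])
    finally show ?case using e by (simp add: dist_norm)
  qed
qed

lemma vanishes_at_infinity_zero: "vanishes_at_infinity (\<lambda>_. 0)"
  by (simp add: vanishes_at_infinity_def)

lemma vanishes_at_infinity_add:
  assumes "vanishes_at_infinity a" "vanishes_at_infinity b"
  shows "vanishes_at_infinity (\<lambda>t. a t + b t)"
  unfolding vanishes_at_infinity_def
proof (intro allI impI)
  fix e :: real assume "0 < e"
  then have "finite ({t. e / 2 \<le> cmod (a t)} \<union> {t. e / 2 \<le> cmod (b t)})"
    using assms unfolding vanishes_at_infinity_def by (intro finite_UnI) (metis half_gt_zero)+
  moreover have "e / 2 \<le> cmod (a t) \<or> e / 2 \<le> cmod (b t)" if "e \<le> cmod (a t + b t)" for t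
    using that norm_triangle_ineq[of "a t" "b t"] by linarith
  ultimately show "finite {t. e \<le> cmod (a t + b t)}"
    by (elim finite_subset[rotated]) auto
qed

lemma vanishes_at_infinity_scale:
  assumes "vanishes_at_infinity a"
  shows "vanishes_at_infinity (\<lambda>t. c * a t)"
proof (cases "c = 0")
  case False
  then have "{t. e \<le> cmod (c * a t)} = {t. e / cmod c \<le> cmod (a t)}" for e
    by (auto simp: norm_mult field_simps)
  then show ?thesis
    using assms False by (simp add: vanishes_at_infinity_def)
qed (simp add: vanishes_at_infinity_zero)

lemma vanishes_at_infinity_uniform_limit:
  assumes "\<And>e. 0 < e \<Longrightarrow> \<exists>b. vanishes_at_infinity b \<and> (\<forall>t. cmod (b t - a t) < e)"
  shows "vanishes_at_infinity a"
  unfolding vanishes_at_infinity_def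
proof (intro allI impI)
  fix e :: real assume "0 < e"
  then obtain b where b: "vanishes_at_infinity b" "\<And>t. cmod (b t - a t) < e / 2"
    using assms[of "e / 2"] by auto
  have "e / 2 \<le> cmod (b t)" if "e \<le> cmod (a t)" for t
    using that b(2)[of t] norm_triangle_ineq3[of "b t" "a t"] by linarith
  then show "finite {t. e \<le> cmod (a t)}"
    using b(1) \<open>0 < e\<close> unfolding vanishes_at_infinity_def
    by (elim allE[of _ "e / 2"]) (auto elim!: finite_subset[rotated])
qed

lemma tendsto_uniform_limit:
  fixes u :: "nat \<Rightarrow> complex"
  assumes "\<And>e. 0 < e \<Longrightarrow> \<exists>v z. v \<longlonglongrightarrow> z \<and> (\<forall>k. cmod (v k - u k) \<le> e) \<and> cmod (z - w) \<le> e"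
  shows "u \<longlonglongrightarrow> w"
proof (rule tendstoI)
  fix e :: real assume e: "0 < e"
  then obtain v z where vz: "v \<longlonglongrightarrow> z" "\<And>k. cmod (v k - u k) \<le> e / 4" "cmod (z - w) \<le> e / 4"
    using assms[of "e / 4"] by auto
  have "eventually (\<lambda>k. dist (v k) z < e / 4) sequentially"
    using vz(1) e by (intro tendstoD) auto
  then show "eventually (\<lambda>k. dist (u k) w < e) sequentially"
  proof eventually_elim
    case (elim k)
    have "dist (u k) w \<le> dist (v k) (u k) + dist (v k) z + dist z w"
      by metric
    then show ?case
      using elim e vz(2)[of k] vz(3) by (simp add: dist_norm)
  qed
qed

section \<open>The two operator spaces\<close>

text \<open>The index set of the larger space: for each level \<open>n\<close> a copy of the real line, and a copy of
  the countable set of intervals \<open>cell k j\<close>.\<close>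

datatype index = Point nat real | Cell nat nat int

definition cell :: "nat \<Rightarrow> int \<Rightarrow> real set"
  where "cell k j = {s. \<lfloor>real k * s\<rfloor> = j}"

lemma eventually_not_in_cell:
  assumes "s \<noteq> t"
  shows "eventually (\<lambda>k. s \<notin> cell k \<lfloor>real k * t\<rfloor>) sequentially"
proof -
  obtain K where K: "1 / \<bar>s - t\<bar> < real K"
    using reals_Archimedean2 by blast
  show ?thesis
  proof (rule eventually_sequentiallyI[of K])
    fix k assume "K \<le> k"
    then have "1 / \<bar>s - t\<bar> < real k" using K by linarith
    then have "1 < real k * \<bar>s - t\<bar>"
      using assms by (simp add: field_simps)
    also have "\<dots> = \<bar>real k * s - real k * t\<bar>"
      by (simp add: abs_mult flip: right_diff_distrib)
    finally show "s \<notin> cell k \<lfloor>real k * t\<rfloor>"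
      unfolding cell_def by simp linarith
  qed
qed

text \<open>Basis vectors of the ambient Hilbert space are indexed by sets of reals; points are sent to
  finite sets, which remember \<open>t\<close> as their minimum and \<open>n\<close> through their cardinality, and cells to
  infinite ones.\<close>

fun position :: "index \<Rightarrow> real set"
  where
    "position (Point n t) = (\<lambda>i. t + real i) ` {..n}"
  | "position (Cell n k j) = {..< real (to_nat (n, k, j))}"

lemma inj_position: "inj position"
proof (rule injI)
  have card: "card (position (Point n t)) = Suc n" for n t
    by (simp add: card_image inj_on_def)
  have Min: "Min (position (Point n t)) = t" for n t
    by (rule Min_eqI) auto
  have infinite: "infinite (position (Cell n k j))" for n k j
    by (simp add: infinite_Iio)
  fix x y assume eq: "position x = position y"
  show "x = y"
  proof (cases x; cases y)
    fix n t m s assume xy: "x = Point n t" "y = Point m s"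
    have "n = m" using eq card[of n t] card[of m s] unfolding xy by (metis nat.inject)
    moreover have "t = s" using eq Min[of n t] Min[of m s] unfolding xy by metis
    ultimately show "x = y" using xy by blast
  next
    fix n t m k j assume "x = Point n t" "y = Cell m k j"
    with eq infinite[of m k j] show "x = y" by (metis finite_atMost finite_imageI position.simps(1))
  next
    fix n t m k j assume "x = Cell m k j" "y = Point n t"
    with eq infinite[of m k j] show "x = y" by (metis finite_atMost finite_imageI position.simps(1))
  next
    fix n k j m l i assume "x = Cell n k j" "y = Cell m l i"
    with eq show "x = y" by simp
  qed
qed

declare position.simps [simp del]

lemma position_eq_iff [simp]: "position x = position y \<longleftrightarrow> x = y"
  using inj_position by (auto dest: injD)

text \<open>A copy of \<open>c\<^sub>0\<close> of the real line, placed on the points of level \<open>0\<close>.\<close>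

definition domain_entries :: "(real set \<Rightarrow> complex) \<Rightarrow> bool"
  where "domain_entries a \<longleftrightarrow> vanishes_at_infinity a \<and>
    (\<forall>p. p \<notin> range (\<lambda>t. position (Point 0 t)) \<longrightarrow> a p = 0)"

text \<open>At each level the values at the points are determined by the values at the cells: a bounded
  function on the cells belongs to the space when it converges along the cells that shrink to any
  given point, so that taking limits is a linear map defined on it which reverses the lifting.
  The weight \<open>1 / (4 n\<^sup>2)\<close> by which the lifting is multiplied at level \<open>n\<close> compensates for its
  Lipschitz constant \<open>4\<close> and for the factor \<open>n\<^sup>2\<close> of \<open>scalar_matrix_bound_entrywise\<close>; the
  definition undoes it. For \<open>n = 0\<close> the condition makes the values at the points vanish.\<close>

definition target_entries :: "(real set \<Rightarrow> complex) \<Rightarrow> bool"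
  where "target_entries h \<longleftrightarrow> (\<forall>p. p \<notin> range position \<longrightarrow> h p = 0) \<and>
    (\<forall>n t. (\<lambda>k. 4 * of_nat n ^ 2 * h (position (Cell n k \<lfloor>real k * t\<rfloor>)))
      \<longlonglongrightarrow> h (position (Point n t)))"

definition domain_space :: "(big_hilbert \<Rightarrow>\<^sub>L big_hilbert) set"
  where "domain_space = {T. diagonal T \<and> domain_entries (entry T)}"

definition target_space :: "(big_hilbert \<Rightarrow>\<^sub>L big_hilbert) set"
  where "target_space = {T. diagonal T \<and> target_entries (entry T)}"

lemma operator_space_domain_space: "operator_space domain_space"
  unfolding domain_space_def
proof (rule operator_space_diagonalI)
  fix a assume a: "\<And>e. 0 < e \<Longrightarrow> \<exists>b. domain_entries b \<and> (\<forall>t. cmod (b t - a t) < e)"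
  have "a p = 0" if "p \<notin> range (\<lambda>t. position (Point 0 t))" for p
  proof (rule ccontr)
    assume "a p \<noteq> 0"
    then obtain b where "domain_entries b" "cmod (b p - a p) < cmod (a p)"
      using a[of "cmod (a p)"] by auto
    then show False using that by (simp add: domain_entries_def)
  qed
  moreover have "vanishes_at_infinity a"
    using a unfolding domain_entries_def by (intro vanishes_at_infinity_uniform_limit) blast
  ultimately show "domain_entries a"
    by (simp add: domain_entries_def)
qed (auto simp: domain_entries_def vanishes_at_infinity_zero vanishes_at_infinity_add
      vanishes_at_infinity_scale)

lemma operator_space_target_space: "operator_space target_space"
  unfolding target_space_def
proof (rule operator_space_diagonalI)
  fix a b assume ab: "target_entries a" "target_entries b"
  show "target_entries (\<lambda>p. a p + b p)"
    using ab unfolding target_entries_def by (auto simp: distrib_left intro!: tendsto_add)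
next
  fix c a assume a: "target_entries a"
  have "(\<lambda>k. 4 * of_nat n ^ 2 * (c * a (position (Cell n k \<lfloor>real k * t\<rfloor>))))
      \<longlonglongrightarrow> c * a (position (Point n t))" for n t
  proof -
    have "(\<lambda>k. c * (4 * of_nat n ^ 2 * a (position (Cell n k \<lfloor>real k * t\<rfloor>))))
        \<longlonglongrightarrow> c * a (position (Point n t))"
      using a unfolding target_entries_def by (intro tendsto_mult_left) blast
    then show ?thesis by (simp only: mult_ac)
  qed
  then show "target_entries (\<lambda>p. c * a p)"
    using a unfolding target_entries_def by simp
next
  fix a assume a: "\<And>e. 0 < e \<Longrightarrow> \<exists>b. target_entries b \<and> (\<forall>t. cmod (b t - a t) < e)"
  have "a p = 0" if "p \<notin> range position" for p
  proof (rule ccontr)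
    assume "a p \<noteq> 0"
    then obtain b where "target_entries b" "cmod (b p - a p) < cmod (a p)"
      using a[of "cmod (a p)"] by auto
    then show False using that by (simp add: target_entries_def)
  qed
  moreover have "(\<lambda>k. 4 * of_nat n ^ 2 * a (position (Cell n k \<lfloor>real k * t\<rfloor>)))
      \<longlonglongrightarrow> a (position (Point n t))" for n t
  proof (rule tendsto_uniform_limit)
    fix e :: real assume e: "0 < e"
    define w where "w = 4 * real n ^ 2"
    have w: "0 \<le> w" by (simp add: w_def)
    obtain b where b: "target_entries b" "\<And>p. cmod (b p - a p) < e / (w + 1)"
      using a[of "e / (w + 1)"] e w by auto
    have small: "cmod (b p - a p) \<le> e" "w * cmod (b p - a p) \<le> e" for p
    proof -
      have "w * cmod (b p - a p) + cmod (b p - a p) < e"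
        using b(2)[of p] w by (simp add: field_simps)
      then show "cmod (b p - a p) \<le> e" "w * cmod (b p - a p) \<le> e"
        using mult_nonneg_nonneg[OF w norm_ge_zero, of "b p - a p"] norm_ge_zero[of "b p - a p"]
        by linarith+
    qed
    let ?q = "\<lambda>k. position (Cell n k \<lfloor>real k * t\<rfloor>)"
    show "\<exists>v z. v \<longlonglongrightarrow> z \<and> (\<forall>k. cmod (v k - 4 * of_nat n ^ 2 * a (?q k)) \<le> e)
        \<and> cmod (z - a (position (Point n t))) \<le> e"
    proof (intro exI conjI allI)
      show "(\<lambda>k. 4 * of_nat n ^ 2 * b (?q k)) \<longlonglongrightarrow> b (position (Point n t))"
        using b(1) unfolding target_entries_def by blast
      show "cmod (4 * of_nat n ^ 2 * b (?q k) - 4 * of_nat n ^ 2 * a (?q k)) \<le> e" for k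
        using small(2)[of "?q k"] unfolding right_diff_distrib[symmetric] w_def
        by (simp add: norm_mult norm_power)
      show "cmod (b (position (Point n t)) - a (position (Point n t))) \<le> e"
        by (rule small)
    qed
  qed
  ultimately show "target_entries a"
    by (simp add: target_entries_def)
qed (simp add: target_entries_def)

section \<open>The almost complete isometric embedding\<close>

definition coefficient :: "(big_hilbert \<Rightarrow>\<^sub>L big_hilbert) \<Rightarrow> real \<Rightarrow> complex"
  where "coefficient T t = entry T (position (Point 0 t))"

definition lifted_entries :: "nat \<Rightarrow> (real \<Rightarrow> complex) \<Rightarrow> real set \<Rightarrow> complex"
  where "lifted_entries n a p =
    (if p \<in> range position then
      (case inv position p of
        Point m t \<Rightarrow> if m = n then a t else 0
      | Cell m k j \<Rightarrow> if m = n then lift_on a (cell k j) / (4 * of_nat n ^ 2) else 0)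
     else 0)"

definition level_map :: "nat \<Rightarrow> (big_hilbert \<Rightarrow>\<^sub>L big_hilbert) \<Rightarrow> big_hilbert \<Rightarrow>\<^sub>L big_hilbert"
  where "level_map n T = diag (lifted_entries n (coefficient T))"

lemma lifted_entries_simps [simp]:
  "lifted_entries n a (position (Point m t)) = (if m = n then a t else 0)"
  "lifted_entries n a (position (Cell m k j)) =
    (if m = n then lift_on a (cell k j) / (4 * of_nat n ^ 2) else 0)"
  "p \<notin> range position \<Longrightarrow> lifted_entries n a p = 0"
  by (simp_all add: lifted_entries_def inv_f_f[OF inj_position])

lemma bounded_coefficient: "bounded (range (coefficient T))"
  by (rule bounded_subset[OF bounded_entry[of T]]) (auto simp: coefficient_def)

lemma bounded_lifted_entries:
  assumes a: "bounded (range a)"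
  shows "bounded (range (lifted_entries n a))"
proof -
  obtain K where K: "cmod (a t) \<le> K" for t
    using a by (auto simp: bounded_iff)
  have K0: "0 \<le> K" using K[of 0] norm_ge_zero order_trans by blast
  have lift: "cmod (lift_on a S) \<le> 4 * K" for S
  proof -
    have "lift_on (\<lambda>_. 0) S = 0"
      by (cases "S = {}") (simp_all add: lift_on_def sup_pos_def zero_complex.ctr)
    then show ?thesis
      using lift_on_lipschitz[OF a, of "\<lambda>_. 0" K S] K K0 by simp
  qed
  have cell_bound: "cmod (lift_on a S / (4 * of_nat n ^ 2)) \<le> K" for S
  proof (cases "n = 0")
    case False
    then have "1 \<le> real n ^ 2" by simp
    then have "4 * K * 1 \<le> 4 * K * real n ^ 2" using K0 by (intro mult_left_mono) auto
    then have "cmod (lift_on a S) \<le> K * (4 * real n ^ 2)" using lift[of S] by simp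
    then show ?thesis using False by (simp add: norm_divide norm_mult norm_power divide_le_eq)
  qed (use K0 in simp)
  have "cmod (lifted_entries n a p) \<le> K" for p
  proof (cases "p \<in> range position")
    case True
    then obtain x where "p = position x" by blast
    then show ?thesis
      using K K0 cell_bound
      by (cases x) auto
  qed (use K0 in simp)
  then show ?thesis unfolding bounded_iff by blast
qed

lemma entry_level_map: "entry (level_map n T) = lifted_entries n (coefficient T)"
  unfolding level_map_def by (intro entry_diag bounded_lifted_entries bounded_coefficient)

lemma diagonal_level_map: "diagonal (level_map n T)"
  unfolding level_map_def by (intro diagonal_diag bounded_lifted_entries bounded_coefficient)

lemma level_map_in_target_space:
  assumes n: "n \<ge> 1" and T: "T \<in> domain_space"
  shows "level_map n T \<in> target_space"
proof -
  let ?a = "coefficient T"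
  have "vanishes_at_infinity ?a"
    unfolding vanishes_at_infinity_def
  proof (intro allI impI)
    fix e :: real assume "0 < e"
    then have "finite {p. e \<le> cmod (entry T p)}"
      using T by (simp add: domain_space_def domain_entries_def vanishes_at_infinity_def)
    then have "finite ((\<lambda>t. position (Point 0 t)) -` {p. e \<le> cmod (entry T p)})"
      by (rule finite_vimageI) (simp add: inj_def)
    then show "finite {t. e \<le> cmod (?a t)}"
      by (simp add: vimage_def coefficient_def)
  qed
  then have "(\<lambda>k. lift_on ?a (cell k \<lfloor>real k * t\<rfloor>)) \<longlonglongrightarrow> ?a t" for t
    by (rule lift_on_tendsto[OF bounded_coefficient])
       (simp add: cell_def, rule eventually_not_in_cell)
  then have "target_entries (lifted_entries n ?a)"
    using n unfolding target_entries_def by (auto simp: field_simps)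
  then show ?thesis
    by (simp add: target_space_def diagonal_level_map entry_level_map)
qed

lemma scalar_matrix_bound_cong:
  assumes "\<And>i j. i < n \<Longrightarrow> j < n \<Longrightarrow> m i j = m' i j"
  shows "scalar_matrix_bound n m B \<longleftrightarrow> scalar_matrix_bound n m' B"
  unfolding scalar_matrix_bound_def using assms by (simp cong: L2_set_cong_simp)

text \<open>The points of level \<open>n\<close> reproduce the norm of the domain exactly, the cells contribute at
  most as much, by the choice of the weight, and all other entries vanish.\<close>

lemma level_map_isometry:
  assumes n: "n \<ge> 1"
  shows "isometry_on (matrices n domain_space) (matrix_dist n) (matrix_dist n)
    (amplification n (level_map n))"
  unfolding isometry_on_def
proof (intro ballI)
  fix A B assume A: "A \<in> matrices n domain_space" and B: "B \<in> matrices n domain_space"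
  define M where "M = (\<lambda>i j. A i j - B i j)"
  define N where "N = (\<lambda>i j. level_map n (A i j) - level_map n (B i j))"
  have in_domain: "A i j \<in> domain_space" "B i j \<in> domain_space" if "i < n" "j < n" for i j
    using A B that unfolding matrices_def by force+
  have diagM: "diagonal (M i j)" if "i < n" "j < n" for i j
    using in_domain[OF that] by (simp add: M_def domain_space_def diagonal_diff)
  have diagN: "diagonal (N i j)" for i j
    by (simp add: N_def diagonal_diff diagonal_level_map)
  have entryN: "entry (N i j) p =
      lifted_entries n (coefficient (A i j)) p - lifted_entries n (coefficient (B i j)) p" for i j p
    by (simp add: N_def entry_diff entry_level_map)
  have point: "entry (N i j) (position (Point n t)) = entry (M i j) (position (Point 0 t))" for i j t
    by (simp add: entryN M_def entry_diff coefficient_def)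
  have "matrix_norm n N \<le> matrix_norm n M"
  proof (rule matrix_norm_diagonal_le_iff[THEN iffD2, OF diagN matrix_norm_nonneg], rule allI)
    fix p
    let ?K = "matrix_norm n M"
    have M: "scalar_matrix_bound n (\<lambda>i j. entry (M i j) q) ?K" for q
      using matrix_norm_diagonal_le_iff[of n M ?K] diagM matrix_norm_nonneg by blast
    show "scalar_matrix_bound n (\<lambda>i j. entry (N i j) p) ?K"
    proof (cases "p \<in> range position")
      case False
      then show ?thesis by (simp add: entryN scalar_matrix_bound_zero matrix_norm_nonneg)
    next
      case True
      then obtain x where p: "p = position x" by blast
      show ?thesis
      proof (cases x)
        case (Point m t)
        show ?thesis
        proof (cases "m = n")
          case True
          then show ?thesis using M by (simp add: p Point point)
        next
          case False
          then show ?thesis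
            by (simp add: p Point entryN scalar_matrix_bound_zero matrix_norm_nonneg)
        qed
      next
        case (Cell m k j)
        show ?thesis
        proof (rule scalar_matrix_bound_entrywise[OF matrix_norm_nonneg])
          fix i l assume il: "i < n" "l < n"
          have "cmod (coefficient (A i l) t - coefficient (B i l) t) \<le> ?K" for t
            using cmod_entry_le_norm[of "M i l" "position (Point 0 t)"]
              norm_entry_le_matrix_norm[OF il, of M]
            by (simp add: M_def entry_diff coefficient_def)
          then have "cmod (lift_on (coefficient (A i l)) (cell k j)
              - lift_on (coefficient (B i l)) (cell k j)) \<le> 4 * ?K"
            by (intro lift_on_lipschitz bounded_coefficient matrix_norm_nonneg)
          then show "cmod (entry (N i l) p) \<le> ?K / real n ^ 2"
            using n matrix_norm_nonneg[of n M]
            by (auto simp: p Cell entryN norm_divide norm_mult norm_power field_simps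
                simp flip: diff_divide_distrib)
        qed
      qed
    qed
  qed
  moreover have "matrix_norm n M \<le> matrix_norm n N"
  proof (rule matrix_norm_diagonal_le_iff[THEN iffD2, OF diagM matrix_norm_nonneg], assumption+,
      rule allI)
    fix p
    let ?K = "matrix_norm n N"
    show "scalar_matrix_bound n (\<lambda>i j. entry (M i j) p) ?K"
    proof (cases "p \<in> range (\<lambda>t. position (Point 0 t))")
      case True
      then obtain t where "p = position (Point 0 t)" by blast
      moreover have "scalar_matrix_bound n (\<lambda>i j. entry (N i j) (position (Point n t))) ?K"
        using matrix_norm_diagonal_le_iff[of n N ?K] diagN matrix_norm_nonneg by blast
      ultimately show ?thesis by (simp add: point)
    next
      case False
      then have "entry (M i j) p = 0" if "i < n" "j < n" for i j
        using in_domain[OF that] by (simp add: M_def entry_diff domain_space_def domain_entries_def)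
      then show ?thesis
        using scalar_matrix_bound_cong[of n "\<lambda>i j. entry (M i j) p" "\<lambda>i j. 0"]
          scalar_matrix_bound_zero[OF matrix_norm_nonneg] by blast
    qed
  qed
  moreover have "matrix_dist n (amplification n (level_map n) A) (amplification n (level_map n) B)
      = matrix_norm n N"
    unfolding matrix_dist_def by (rule matrix_norm_cong) (simp add: amplification_def N_def)
  ultimately show "matrix_dist n (amplification n (level_map n) A) (amplification n (level_map n) B)
      = matrix_dist n A B"
    by (simp add: matrix_dist_def M_def)
qed

lemma domain_space_almost_completely_isometrically_embeds:
  "almost_completely_isometrically_embeds domain_space target_space"
  unfolding almost_completely_isometrically_embeds_def almost_complete_isometric_embedding_def
  using level_map_in_target_space level_map_isometry by blast

section \<open>The obstruction to isomorphic embeddings\<close>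

definition atom :: "real \<Rightarrow> big_hilbert \<Rightarrow>\<^sub>L big_hilbert"
  where "atom t = diag (\<lambda>p. if p = position (Point 0 t) then 1 else 0)"

lemma entry_atom: "entry (atom t) p = (if p = position (Point 0 t) then 1 else 0)"
  and diagonal_atom: "diagonal (atom t)"
proof -
  have "bounded (range (\<lambda>p. if p = position (Point 0 t) then 1 else 0 :: complex))"
    by (rule finite_imp_bounded, rule finite_subset[of _ "{0, 1}"]) auto
  then show "entry (atom t) p = (if p = position (Point 0 t) then 1 else 0)" "diagonal (atom t)"
    unfolding atom_def by (simp_all add: entry_diag diagonal_diag)
qed

lemma norm_atom_ge_1: "1 \<le> norm (atom t)"
  using cmod_entry_le_norm[of "atom t" "position (Point 0 t)"] by (simp add: entry_atom)

lemma atom_in_domain_space: "atom t \<in> domain_space"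
proof -
  have "finite {p. e \<le> cmod (entry (atom t) p)}" if "0 < e" for e
    by (rule finite_subset[of _ "{position (Point 0 t)}"]) (use that in \<open>auto simp: entry_atom\<close>)
  then show ?thesis
    by (auto simp: domain_space_def diagonal_atom domain_entries_def vanishes_at_infinity_def entry_atom)
qed

text \<open>Bounded functionals on \<open>c\<^sub>0\<close> of an uncountable set have countable support. A combination of distinct atoms with coefficients of modulus at most \<open>1\<close> has norm at most
  \<open>1\<close>; choosing the signs of the values of a functional as coefficients shows that these values are
  absolutely summable.\<close>

lemma countable_support_on_atoms:
  fixes \<phi> :: "(big_hilbert \<Rightarrow>\<^sub>L big_hilbert) \<Rightarrow> real"
  assumes lin: "real_linear_on domain_space \<phi>"
    and bound: "\<And>T. T \<in> domain_space \<Longrightarrow> \<bar>\<phi> T\<bar> \<le> C * norm T"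
  shows "countable {t. \<phi> (atom t) \<noteq> 0}"
proof -
  have X0: "0 \<in> domain_space"
    using operator_space_domain_space unfolding operator_space_def by blast
  have X_add: "S + T \<in> domain_space" if "S \<in> domain_space" "T \<in> domain_space" for S T
    using operator_space_domain_space that unfolding operator_space_def by blast
  have X_scale: "r *\<^sub>R T \<in> domain_space" if "T \<in> domain_space" for r T
  proof -
    have "complex_of_real r *\<^sub>C T \<in> domain_space"
      using operator_space_domain_space that unfolding operator_space_def by blast
    then show ?thesis by (simp only: scaleC_of_real)
  qed
  let ?s = "\<lambda>t. sgn (\<phi> (atom t))"
  have C: "0 \<le> C"
  proof -
    have "norm (atom 0) > 0" using norm_atom_ge_1[of 0] by linarith
    moreover have "0 \<le> C * norm (atom 0)"
      using bound[OF atom_in_domain_space[of 0]] by linarith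
    ultimately show ?thesis by (simp add: zero_le_mult_iff)
  qed
  have finite_sum: "(\<Sum>t\<in>F. \<bar>\<phi> (atom t)\<bar>) \<le> C" if "finite F" for F
  proof -
    define T where "T = (\<Sum>t\<in>F. ?s t *\<^sub>R atom t)"
    have "T \<in> domain_space \<and> \<phi> T = (\<Sum>t\<in>F. \<bar>\<phi> (atom t)\<bar>)"
      using that unfolding T_def
    proof (induction F)
      case empty
      then show ?case using X0 real_linear_on_zero[OF lin] by simp
    next
      case (insert t F)
      have "?s t *\<^sub>R atom t \<in> domain_space" "\<phi> (?s t *\<^sub>R atom t) = \<bar>\<phi> (atom t)\<bar>"
        using lin X_scale atom_in_domain_space
        by (auto simp: real_linear_on_def sgn_mult_self_eq abs_sgn mult.commute)
      then show ?case
        using insert lin X_add by (simp add: real_linear_on_def)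
    qed
    then have T: "T \<in> domain_space" "\<phi> T = (\<Sum>t\<in>F. \<bar>\<phi> (atom t)\<bar>)" by auto
    have entry_T: "entry T p = (\<Sum>t\<in>F. ?s t *\<^sub>R entry (atom t) p)" for p
    proof -
      interpret bounded_linear "\<lambda>S. entry S p"
        by (rule bounded_linear_entry)
      show ?thesis
        unfolding T_def by (simp only: sum scaleR)
    qed
    have "norm T \<le> 1"
    proof (rule norm_diagonal_le)
      show "diagonal T" using T(1) by (simp add: domain_space_def)
      fix p
      show "cmod (entry T p) \<le> 1"
      proof (cases "p \<in> range (\<lambda>t. position (Point 0 t))")
        case True
        then obtain s where p: "p = position (Point 0 s)" by blast
        have "entry T p = (\<Sum>t\<in>F. if t = s then of_real (?s s) else 0)"
          unfolding entry_T by (intro sum.cong) (auto simp: entry_atom p scaleR_conv_of_real)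
        then show ?thesis using that by (auto simp: abs_sgn_eq)
      next
        case False
        then show ?thesis
          using T(1) by (simp add: domain_space_def domain_entries_def)
      qed
    qed simp
    then have "C * norm T \<le> C" using C by (simp add: mult_left_le)
    then show ?thesis using bound[OF T(1)] T(2) by linarith
  qed
  have "(\<lambda>t. \<bar>\<phi> (atom t)\<bar>) summable_on UNIV"
    by (rule nonneg_bdd_above_summable_on) (use finite_sum in \<open>auto intro!: bdd_aboveI2\<close>)
  from summable_countable_real[OF this] show ?thesis
    by simp
qed

text \<open>In contrast, the countably many functionals given by the cells separate the points of the
  target, because the values at the cells determine all the others through limits.\<close>

lemma target_space_eq_0I:
  assumes T: "T \<in> target_space" and cells: "\<And>n k j. entry T (position (Cell n k j)) = 0"
  shows "T = 0"
proof (rule diagonal_eqI)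
  show "diagonal T" using T by (simp add: target_space_def)
  show "diagonal (0 :: big_hilbert \<Rightarrow>\<^sub>L big_hilbert)"
    by (simp add: diagonal_def zero_ell2.rep_eq entry_zero)
  fix p
  have h: "target_entries (entry T)" using T by (simp add: target_space_def)
  have point: "entry T (position (Point n t)) = 0" for n t
  proof (rule LIMSEQ_unique)
    show "(\<lambda>k. 4 * of_nat n ^ 2 * entry T (position (Cell n k \<lfloor>real k * t\<rfloor>)))
        \<longlonglongrightarrow> entry T (position (Point n t))"
      using h unfolding target_entries_def by blast
  qed (simp add: cells)
  have "entry T (position x) = 0" for x
    by (cases x) (simp_all add: cells point)
  then show "entry T p = entry 0 p"
    using h unfolding target_entries_def entry_zero by (cases "p \<in> range position") auto
qed

text \<open>An embedding would pull the countable separating family of the target back to the domain,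
  where the countable supports of its members cannot cover the real line.\<close>

lemma not_real_isomorphically_embeds:
  "\<not> real_isomorphically_embeds domain_space target_space"
proof
  assume "real_isomorphically_embeds domain_space target_space"
  then obtain f C c where f: "f \<in> domain_space \<rightarrow> target_space"
    and lin: "real_linear_on domain_space f"
    and C: "\<And>T. T \<in> domain_space \<Longrightarrow> norm (f T) \<le> C * norm T"
    and c: "c > 0" "\<And>T. T \<in> domain_space \<Longrightarrow> c * norm T \<le> norm (f T)"
    unfolding real_isomorphically_embeds_def isomorphic_embedding_def by blast
  define N where "N x = {t. entry (f (atom t)) (position x) \<noteq> 0}" for x
  have "countable (N x)" for x
  proof -
    have *: "countable {t. g (entry (f (atom t)) (position x)) \<noteq> 0}"
      if g: "bounded_linear g" "\<And>z. \<bar>g z\<bar> \<le> cmod z" for g :: "complex \<Rightarrow> real"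
    proof (rule countable_support_on_atoms)
      interpret bounded_linear "\<lambda>T. g (entry T (position x))"
        by (rule bounded_linear_compose[OF g(1) bounded_linear_entry])
      show "real_linear_on domain_space (\<lambda>T. g (entry (f T) (position x)))"
        using lin unfolding real_linear_on_def by (simp add: add scaleR)
      show "\<bar>g (entry (f T) (position x))\<bar> \<le> C * norm T" if "T \<in> domain_space" for T
        using g(2)[of "entry (f T) (position x)"] cmod_entry_le_norm[of "f T" "position x"] C[OF that]
        by linarith
    qed
    have "countable ({t. Re (entry (f (atom t)) (position x)) \<noteq> 0}
        \<union> {t. Im (entry (f (atom t)) (position x)) \<noteq> 0})"
      by (intro countable_Un * bounded_linear_Re bounded_linear_Im abs_Re_le_cmod abs_Im_le_cmod)
    then show ?thesis
      unfolding N_def by (rule countable_subset[rotated]) (auto simp: complex_eq_iff)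
  qed
  then have "countable (\<Union>(n, k, j)\<in>UNIV. N (Cell n k j))"
    by (intro countable_UN) auto
  then have "(\<Union>(n, k, j)\<in>UNIV. N (Cell n k j)) \<noteq> UNIV"
    using uncountable_UNIV_real by auto
  then obtain t where "t \<notin> (\<Union>(n, k, j)\<in>UNIV. N (Cell n k j))" by blast
  then have t: "t \<notin> N (Cell n k j)" for n k j by auto
  have "f (atom t) = 0"
  proof (rule target_space_eq_0I)
    show "f (atom t) \<in> target_space" using f atom_in_domain_space by blast
  qed (use t in \<open>simp add: N_def\<close>)
  then have "norm (atom t) \<le> 0"
    using c(2)[OF atom_in_domain_space, of t] c(1) by (simp add: mult_le_0_iff)
  then show False
    using norm_atom_ge_1[of t] by linarith
qed

theorem theorem1p4:
  shows
    "(\<exists>(X :: (big_hilbert \<Rightarrow>\<^sub>L big_hilbert) set) (Y :: (big_hilbert \<Rightarrow>\<^sub>L big_hilbert) set).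
        operator_space X \<and> operator_space Y \<and>
        almost_completely_isometrically_embeds X Y \<and> \<not> real_isomorphically_embeds X Y)
   \<and> ((\<forall>(X :: ('h::complex_hilbert_space \<Rightarrow>\<^sub>L 'h) set) (Y :: ('k::complex_hilbert_space \<Rightarrow>\<^sub>L 'k) set).
          operator_space X \<and> operator_space Y \<and>
          almost_completely_real_linearly_isometrically_embeds X Y \<longrightarrow>
          almost_completely_isometrically_embeds X Y)
      \<and> (\<exists>(X :: (big_hilbert \<Rightarrow>\<^sub>L big_hilbert) set) (Y :: (big_hilbert \<Rightarrow>\<^sub>L big_hilbert) set).
          operator_space X \<and> operator_space Y \<and>
          almost_completely_isometrically_embeds X Y \<and>
          \<not> almost_completely_real_linearly_isometrically_embeds X Y))
   \<and> ((\<forall>(X :: ('h \<Rightarrow>\<^sub>L 'h) set) (Y :: ('k \<Rightarrow>\<^sub>L 'k) set).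
          operator_space X \<and> operator_space Y \<and>
          almost_completely_real_isomorphically_embeds X Y \<longrightarrow>
          almost_completely_lipschitzly_embeds X Y)
      \<and> (\<exists>(X :: (big_hilbert \<Rightarrow>\<^sub>L big_hilbert) set) (Y :: (big_hilbert \<Rightarrow>\<^sub>L big_hilbert) set).
          operator_space X \<and> operator_space Y \<and>
          almost_completely_lipschitzly_embeds X Y \<and>
          \<not> almost_completely_real_isomorphically_embeds X Y))"
proof (intro conjI allI impI)
  let ?X = domain_space and ?Y = target_space
  have XY: "operator_space ?X" "operator_space ?Y" "almost_completely_isometrically_embeds ?X ?Y"
    "\<not> real_isomorphically_embeds ?X ?Y"
    by (fact operator_space_domain_space operator_space_target_space
        domain_space_almost_completely_isometrically_embeds not_real_isomorphically_embeds)+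
  then have X0: "0 \<in> ?X"
    unfolding operator_space_def by blast
  show "\<exists>(X :: (big_hilbert \<Rightarrow>\<^sub>L big_hilbert) set) (Y :: (big_hilbert \<Rightarrow>\<^sub>L big_hilbert) set).
      operator_space X \<and> operator_space Y \<and>
      almost_completely_isometrically_embeds X Y \<and> \<not> real_isomorphically_embeds X Y"
    using XY by blast
  show "\<exists>(X :: (big_hilbert \<Rightarrow>\<^sub>L big_hilbert) set) (Y :: (big_hilbert \<Rightarrow>\<^sub>L big_hilbert) set).
      operator_space X \<and> operator_space Y \<and>
      almost_completely_isometrically_embeds X Y \<and>
      \<not> almost_completely_real_linearly_isometrically_embeds X Y"
    using XY X0 almost_completely_real_linearly_isometrically_imp_real_isomorphically_embeds by blast
  show "\<exists>(X :: (big_hilbert \<Rightarrow>\<^sub>L big_hilbert) set) (Y :: (big_hilbert \<Rightarrow>\<^sub>L big_hilbert) set).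
      operator_space X \<and> operator_space Y \<and>
      almost_completely_lipschitzly_embeds X Y \<and>
      \<not> almost_completely_real_isomorphically_embeds X Y"
    using XY almost_completely_isometrically_imp_lipschitzly_embeds
      almost_completely_real_isomorphically_imp_real_isomorphically_embeds by blast
next
  fix X :: "('h \<Rightarrow>\<^sub>L 'h) set" and Y :: "('k \<Rightarrow>\<^sub>L 'k) set"
  assume "operator_space X \<and> operator_space Y \<and>
    almost_completely_real_linearly_isometrically_embeds X Y"
  then show "almost_completely_isometrically_embeds X Y"
    unfolding almost_completely_real_linearly_isometrically_embeds_def
      almost_completely_isometrically_embeds_def by blast
next
  fix X :: "('h \<Rightarrow>\<^sub>L 'h) set" and Y :: "('k \<Rightarrow>\<^sub>L 'k) set"
  assume "operator_space X \<and> operator_space Y \<and> almost_completely_real_isomorphically_embeds X Y"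
  then show "almost_completely_lipschitzly_embeds X Y"
    using almost_completely_real_isomorphically_imp_lipschitzly_embeds by blast
qed

end
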